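(* Let $\overline{\Phi}$ be a formula of the language of Nelson's logics that is in negative normal form, and let $\tau(\overline{\Phi})$ be its translation into the modal language of $\mathsf{QBK}$ (translation defined in the context). Then $\overline{\Phi}$ belongs to $\mathsf{QN4}^{\bot}$ (respectively $\mathsf{QN3}$) if and only if $\tau(\overline{\Phi})$ belongs to $\mathsf{QBS4}$ (respectively $\mathsf{QB3S4}$).
   Context: Fix a signature $\sigma$ without function symbols. The language of Nelson's logics uses the connectives $\rightarrow,\wedge,\vee$, strong negation $\sim$, the constant $\bot$ and the quantifiers $\forall,\exists$; a formula is in negative normal form if $\sim$ occurs only in front of atomic subformulas (or $\bot$). $\mathsf{QN4}^{\bot}$ and $\mathsf{QN3}$ are the quantified versions of Nelson's constructive logics $\mathsf{N4}^{\bot}$ and $\mathsf{N3}$; they are strongly complete with respect to Kripke models $\langle W,\leqslant,\mathscr{A}^+,\mathscr{A}^-\rangle$ where $\leqslant$ is a preorder, domains expand along $\leqslant$, and the positive and negative interpretations of every predicate are preserved upward along $\leqslant$ (for $\mathsf{QN3}$ additionally the positive and negative interpretations of each predicate are disjoint in every world). $\mathsf{QBK}$ is the quantified version of the modal logic $\mathsf{BK}$: the least set of formulas (in the language with $\rightarrow,\wedge,\vee,\sim,\bot,\square,\lozenge,\forall,\exists$) containing the axioms of classical propositional logic in $\{\vee,\wedge,\rightarrow,\bot\}$, the strong negation axioms ($\sim\sim\Phi\leftrightarrow\Phi$, $\sim(\Phi\rightarrow\Psi)\leftrightarrow(\Phi\wedge\sim\Psi)$, De Morgan laws for $\sim$,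 $\sim\bot$), the axioms $(\square\Phi\wedge\square\Psi)\rightarrow\square(\Phi\wedge\Psi)$ and $\square(\Phi\rightarrow\Phi)$, the modal interaction axioms ($\neg\square\Phi\leftrightarrow\lozenge\neg\Phi$, $\neg\lozenge\Phi\leftrightarrow\square\neg\Phi$, $\square\Phi\Leftrightarrow\sim\lozenge\sim\Phi$, $\lozenge\Phi\Leftrightarrow\sim\square\sim\Phi$, where $\neg\Phi:=\Phi\rightarrow\bot$ and $\Phi\Leftrightarrow\Psi$ means $(\Phi\leftrightarrow\Psi)\wedge(\sim\Phi\leftrightarrow\sim\Psi)$), the quantifier axioms ($\forall x\,\Phi\rightarrow\Phi(x/t)$, $\Phi(x/t)\rightarrow\exists x\,\Phi$, $\sim\forall x\,\Phi\leftrightarrow\exists x\sim\Phi$, $\sim\exists x\,\Phi\leftrightarrow\forall x\sim\Phi$), and closed under modus ponens, monotonicity rules for $\square$ and $\lozenge$, and Bernays' rules for $\forall$ and $\exists$. It is strongly complete for models with expanding domains in which each world carries two structures (for verification and falsification). $\mathsf{QBS4}$ is the extension of $\mathsf{QBK}$ strongly complete with respect to such models whose accessibility relation is a preorder; $\mathsf{QB3S4}$ is $\mathsf{QBS4}$ extended with the axiom scheme $\sim\Phi\rightarrow(\Phi\rightarrow\Psi)$ (models where no atomic sentence is both verified and falsified in a world). The translation $\tau$ on formulas in negative normal form is defined recursively: $\tau P(t_1,\ldots,t_n)=\square P(t_1,\ldots,t_n)$; $\tau\sim P(t_1,\ldots,t_n)=\sim\lozenge P(t_1,\ldots,t_n)$;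 $\tau(\Phi\vee\Psi)=\tau\Phi\vee\tau\Psi$; $\tau(\Phi\wedge\Psi)=\tau\Phi\wedge\tau\Psi$; $\tau(\Phi\rightarrow\Psi)=\square(\tau\Phi\rightarrow\tau\Psi)$; $\tau\bot=\bot$; $\tau\exists x\Phi=\exists x\,\tau\Phi$; $\tau\forall x\Phi=\square\forall x\,\tau\Phi$. *)

theory Defs
  imports Main
begin

section \<open>Signatures and terms\<close>

text \<open>
  There are no function symbols of positive arity. The predicate and constant symbols are
  carrier sets, so that either of them may be empty.
\<close>

record ('p, 'c) signature =
  preds :: "'p set"
  arity :: "'p \<Rightarrow> nat"
  constants :: "'c set"

datatype 'c tm = Var nat | Const 'c

primrec tm_vars :: "'c tm \<Rightarrow> nat set" where
  "tm_vars (Var x) = {x}"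
| "tm_vars (Const c) = {}"

primrec tm_wf :: "('p, 'c) signature \<Rightarrow> 'c tm \<Rightarrow> bool" where
  "tm_wf \<sigma> (Var x) \<longleftrightarrow> True"
| "tm_wf \<sigma> (Const c) \<longleftrightarrow> c \<in> constants \<sigma>"

primrec tm_subst :: "nat \<Rightarrow> 'c tm \<Rightarrow> 'c tm \<Rightarrow> 'c tm" where
  "tm_subst x t (Var y) = (if y = x then t else Var y)"
| "tm_subst x t (Const c) = Const c"


section \<open>The language of Nelson's logics\<close>

datatype ('p, 'c) nfm =
    NAtom 'p "'c tm list"
  | NBot ("\<bottom>\<^sub>N")
  | NImp "('p, 'c) nfm" "('p, 'c) nfm" (infixr "\<rightarrow>\<^sub>N" 56)
  | NAnd "('p, 'c) nfm" "('p, 'c) nfm" (infixr "\<and>\<^sub>N" 58)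
  | NOr "('p, 'c) nfm" "('p, 'c) nfm" (infixr "\<or>\<^sub>N" 57)
  | NNeg "('p, 'c) nfm" ("\<sim>\<^sub>N _" [60] 60)
  | NAll nat "('p, 'c) nfm"
  | NEx nat "('p, 'c) nfm"

abbreviation NIff :: "('p, 'c) nfm \<Rightarrow> ('p, 'c) nfm \<Rightarrow> ('p, 'c) nfm" (infix "\<leftrightarrow>\<^sub>N" 55) where
  "\<Phi> \<leftrightarrow>\<^sub>N \<Psi> \<equiv> (\<Phi> \<rightarrow>\<^sub>N \<Psi>) \<and>\<^sub>N (\<Psi> \<rightarrow>\<^sub>N \<Phi>)"

primrec nfm_wf :: "('p, 'c) signature \<Rightarrow> ('p, 'c) nfm \<Rightarrow> bool" where
  "nfm_wf \<sigma> (NAtom P ts) \<longleftrightarrow> P \<in> preds \<sigma> \<and> length ts = arity \<sigma> P \<and> (\<forall>t\<in>set ts. tm_wf \<sigma> t)"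
| "nfm_wf \<sigma> \<bottom>\<^sub>N \<longleftrightarrow> True"
| "nfm_wf \<sigma> (\<Phi> \<rightarrow>\<^sub>N \<Psi>) \<longleftrightarrow> nfm_wf \<sigma> \<Phi> \<and> nfm_wf \<sigma> \<Psi>"
| "nfm_wf \<sigma> (\<Phi> \<and>\<^sub>N \<Psi>) \<longleftrightarrow> nfm_wf \<sigma> \<Phi> \<and> nfm_wf \<sigma> \<Psi>"
| "nfm_wf \<sigma> (\<Phi> \<or>\<^sub>N \<Psi>) \<longleftrightarrow> nfm_wf \<sigma> \<Phi> \<and> nfm_wf \<sigma> \<Psi>"
| "nfm_wf \<sigma> (\<sim>\<^sub>N \<Phi>) \<longleftrightarrow> nfm_wf \<sigma> \<Phi>"
| "nfm_wf \<sigma> (NAll x \<Phi>) \<longleftrightarrow> nfm_wf \<sigma> \<Phi>"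
| "nfm_wf \<sigma> (NEx x \<Phi>) \<longleftrightarrow> nfm_wf \<sigma> \<Phi>"

primrec nfm_fv :: "('p, 'c) nfm \<Rightarrow> nat set" where
  "nfm_fv (NAtom P ts) = (\<Union>t\<in>set ts. tm_vars t)"
| "nfm_fv \<bottom>\<^sub>N = {}"
| "nfm_fv (\<Phi> \<rightarrow>\<^sub>N \<Psi>) = nfm_fv \<Phi> \<union> nfm_fv \<Psi>"
| "nfm_fv (\<Phi> \<and>\<^sub>N \<Psi>) = nfm_fv \<Phi> \<union> nfm_fv \<Psi>"
| "nfm_fv (\<Phi> \<or>\<^sub>N \<Psi>) = nfm_fv \<Phi> \<union> nfm_fv \<Psi>"
| "nfm_fv (\<sim>\<^sub>N \<Phi>) = nfm_fv \<Phi>"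
| "nfm_fv (NAll x \<Phi>) = nfm_fv \<Phi> - {x}"
| "nfm_fv (NEx x \<Phi>) = nfm_fv \<Phi> - {x}"

text \<open>
  Replacement of the free occurrences of a variable by a term. It does not rename bound
  variables, so the quantifier axioms require the term to be free for the variable.
\<close>

primrec nfm_subst :: "nat \<Rightarrow> 'c tm \<Rightarrow> ('p, 'c) nfm \<Rightarrow> ('p, 'c) nfm" where
  "nfm_subst x t (NAtom P ts) = NAtom P (map (tm_subst x t) ts)"
| "nfm_subst x t \<bottom>\<^sub>N = \<bottom>\<^sub>N"
| "nfm_subst x t (\<Phi> \<rightarrow>\<^sub>N \<Psi>) = nfm_subst x t \<Phi> \<rightarrow>\<^sub>N nfm_subst x t \<Psi>"
| "nfm_subst x t (\<Phi> \<and>\<^sub>N \<Psi>) = nfm_subst x t \<Phi> \<and>\<^sub>N nfm_subst x t \<Psi>"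
| "nfm_subst x t (\<Phi> \<or>\<^sub>N \<Psi>) = nfm_subst x t \<Phi> \<or>\<^sub>N nfm_subst x t \<Psi>"
| "nfm_subst x t (\<sim>\<^sub>N \<Phi>) = \<sim>\<^sub>N (nfm_subst x t \<Phi>)"
| "nfm_subst x t (NAll y \<Phi>) = NAll y (if y = x then \<Phi> else nfm_subst x t \<Phi>)"
| "nfm_subst x t (NEx y \<Phi>) = NEx y (if y = x then \<Phi> else nfm_subst x t \<Phi>)"

primrec nfm_free_for :: "'c tm \<Rightarrow> nat \<Rightarrow> ('p, 'c) nfm \<Rightarrow> bool" where
  "nfm_free_for t x (NAtom P ts) \<longleftrightarrow> True"
| "nfm_free_for t x \<bottom>\<^sub>N \<longleftrightarrow> True"
| "nfm_free_for t x (\<Phi> \<rightarrow>\<^sub>N \<Psi>) \<longleftrightarrow> nfm_free_for t x \<Phi> \<and> nfm_free_for t x \<Psi>"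
| "nfm_free_for t x (\<Phi> \<and>\<^sub>N \<Psi>) \<longleftrightarrow> nfm_free_for t x \<Phi> \<and> nfm_free_for t x \<Psi>"
| "nfm_free_for t x (\<Phi> \<or>\<^sub>N \<Psi>) \<longleftrightarrow> nfm_free_for t x \<Phi> \<and> nfm_free_for t x \<Psi>"
| "nfm_free_for t x (\<sim>\<^sub>N \<Phi>) \<longleftrightarrow> nfm_free_for t x \<Phi>"
| "nfm_free_for t x (NAll y \<Phi>) \<longleftrightarrow>
     x \<notin> nfm_fv (NAll y \<Phi>) \<or> (y \<notin> tm_vars t \<and> nfm_free_for t x \<Phi>)"
| "nfm_free_for t x (NEx y \<Phi>) \<longleftrightarrow>
     x \<notin> nfm_fv (NEx y \<Phi>) \<or> (y \<notin> tm_vars t \<and> nfm_free_for t x \<Phi>)"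

fun nnf :: "('p, 'c) nfm \<Rightarrow> bool" where
  "nnf (NAtom P ts) \<longleftrightarrow> True"
| "nnf \<bottom>\<^sub>N \<longleftrightarrow> True"
| "nnf (\<Phi> \<rightarrow>\<^sub>N \<Psi>) \<longleftrightarrow> nnf \<Phi> \<and> nnf \<Psi>"
| "nnf (\<Phi> \<and>\<^sub>N \<Psi>) \<longleftrightarrow> nnf \<Phi> \<and> nnf \<Psi>"
| "nnf (\<Phi> \<or>\<^sub>N \<Psi>) \<longleftrightarrow> nnf \<Phi> \<and> nnf \<Psi>"
| "nnf (\<sim>\<^sub>N \<Phi>) \<longleftrightarrow> (\<exists>P ts. \<Phi> = NAtom P ts) \<or> \<Phi> = \<bottom>\<^sub>N"
| "nnf (NAll x \<Phi>) \<longleftrightarrow> nnf \<Phi>"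
| "nnf (NEx x \<Phi>) \<longleftrightarrow> nnf \<Phi>"


section \<open>The logics \<open>QN4\<^sup>\<bottom>\<close> and \<open>QN3\<close>\<close>

inductive_set QN4bot_axioms :: "('p, 'c) nfm set" where
  imp_K: "\<Phi> \<rightarrow>\<^sub>N (\<Psi> \<rightarrow>\<^sub>N \<Phi>) \<in> QN4bot_axioms"
| imp_S: "(\<Phi> \<rightarrow>\<^sub>N (\<Psi> \<rightarrow>\<^sub>N \<Theta>)) \<rightarrow>\<^sub>N ((\<Phi> \<rightarrow>\<^sub>N \<Psi>) \<rightarrow>\<^sub>N (\<Phi> \<rightarrow>\<^sub>N \<Theta>)) \<in> QN4bot_axioms"
| and_elim1: "(\<Phi> \<and>\<^sub>N \<Psi>) \<rightarrow>\<^sub>N \<Phi> \<in> QN4bot_axioms"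
| and_elim2: "(\<Phi> \<and>\<^sub>N \<Psi>) \<rightarrow>\<^sub>N \<Psi> \<in> QN4bot_axioms"
| and_intro: "\<Phi> \<rightarrow>\<^sub>N (\<Psi> \<rightarrow>\<^sub>N (\<Phi> \<and>\<^sub>N \<Psi>)) \<in> QN4bot_axioms"
| or_intro1: "\<Phi> \<rightarrow>\<^sub>N (\<Phi> \<or>\<^sub>N \<Psi>) \<in> QN4bot_axioms"
| or_intro2: "\<Psi> \<rightarrow>\<^sub>N (\<Phi> \<or>\<^sub>N \<Psi>) \<in> QN4bot_axioms"
| or_elim: "(\<Phi> \<rightarrow>\<^sub>N \<Theta>) \<rightarrow>\<^sub>N ((\<Psi> \<rightarrow>\<^sub>N \<Theta>) \<rightarrow>\<^sub>N ((\<Phi> \<or>\<^sub>N \<Psi>) \<rightarrow>\<^sub>N \<Theta>)) \<in> QN4bot_axioms"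
| ex_falso: "\<bottom>\<^sub>N \<rightarrow>\<^sub>N \<Phi> \<in> QN4bot_axioms"
| neg_neg: "(\<sim>\<^sub>N \<sim>\<^sub>N \<Phi>) \<leftrightarrow>\<^sub>N \<Phi> \<in> QN4bot_axioms"
| neg_imp: "(\<sim>\<^sub>N (\<Phi> \<rightarrow>\<^sub>N \<Psi>)) \<leftrightarrow>\<^sub>N (\<Phi> \<and>\<^sub>N \<sim>\<^sub>N \<Psi>) \<in> QN4bot_axioms"
| neg_and: "(\<sim>\<^sub>N (\<Phi> \<and>\<^sub>N \<Psi>)) \<leftrightarrow>\<^sub>N (\<sim>\<^sub>N \<Phi> \<or>\<^sub>N \<sim>\<^sub>N \<Psi>) \<in> QN4bot_axioms"
| neg_or: "(\<sim>\<^sub>N (\<Phi> \<or>\<^sub>N \<Psi>)) \<leftrightarrow>\<^sub>N (\<sim>\<^sub>N \<Phi> \<and>\<^sub>N \<sim>\<^sub>N \<Psi>) \<in> QN4bot_axioms"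
| neg_bot: "\<sim>\<^sub>N \<bottom>\<^sub>N \<in> QN4bot_axioms"
| all_inst: "nfm_free_for t x \<Phi> \<Longrightarrow> NAll x \<Phi> \<rightarrow>\<^sub>N nfm_subst x t \<Phi> \<in> QN4bot_axioms"
| ex_inst: "nfm_free_for t x \<Phi> \<Longrightarrow> nfm_subst x t \<Phi> \<rightarrow>\<^sub>N NEx x \<Phi> \<in> QN4bot_axioms"
| neg_all: "(\<sim>\<^sub>N (NAll x \<Phi>)) \<leftrightarrow>\<^sub>N NEx x (\<sim>\<^sub>N \<Phi>) \<in> QN4bot_axioms"
| neg_ex: "(\<sim>\<^sub>N (NEx x \<Phi>)) \<leftrightarrow>\<^sub>N NAll x (\<sim>\<^sub>N \<Phi>) \<in> QN4bot_axioms"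

text \<open>
  The extension of \<open>QN4\<^sup>\<bottom>\<close> by a set of additional axioms. Only axioms in the given signature
  are admitted, and the rules stay within the signature.
\<close>

inductive_set QN4bot_ext ::
  "('p, 'c) signature \<Rightarrow> ('p, 'c) nfm set \<Rightarrow> ('p, 'c) nfm set"
  for \<sigma> :: "('p, 'c) signature" and Ax :: "('p, 'c) nfm set" where
  ax: "\<Phi> \<in> QN4bot_axioms \<union> Ax \<Longrightarrow> nfm_wf \<sigma> \<Phi> \<Longrightarrow> \<Phi> \<in> QN4bot_ext \<sigma> Ax"
| mp: "\<Phi> \<in> QN4bot_ext \<sigma> Ax \<Longrightarrow> \<Phi> \<rightarrow>\<^sub>N \<Psi> \<in> QN4bot_ext \<sigma> Ax \<Longrightarrow> \<Psi> \<in> QN4bot_ext \<sigma> Ax"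
| bernays_all: "\<Phi> \<rightarrow>\<^sub>N \<Psi> \<in> QN4bot_ext \<sigma> Ax \<Longrightarrow> x \<notin> nfm_fv \<Phi> \<Longrightarrow>
    \<Phi> \<rightarrow>\<^sub>N NAll x \<Psi> \<in> QN4bot_ext \<sigma> Ax"
| bernays_ex: "\<Phi> \<rightarrow>\<^sub>N \<Psi> \<in> QN4bot_ext \<sigma> Ax \<Longrightarrow> x \<notin> nfm_fv \<Psi> \<Longrightarrow>
    NEx x \<Phi> \<rightarrow>\<^sub>N \<Psi> \<in> QN4bot_ext \<sigma> Ax"

definition QN4bot :: "('p, 'c) signature \<Rightarrow> ('p, 'c) nfm set" where
  "QN4bot \<sigma> = QN4bot_ext \<sigma> {}"

definition QN3 :: "('p, 'c) signature \<Rightarrow> ('p, 'c) nfm set" where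
  "QN3 \<sigma> = QN4bot_ext \<sigma> {\<sim>\<^sub>N \<Phi> \<rightarrow>\<^sub>N (\<Phi> \<rightarrow>\<^sub>N \<Psi>) | \<Phi> \<Psi>. True}"


section \<open>The modal language\<close>

datatype ('p, 'c) mfm =
    MAtom 'p "'c tm list"
  | MBot ("\<bottom>\<^sub>M")
  | MImp "('p, 'c) mfm" "('p, 'c) mfm" (infixr "\<rightarrow>\<^sub>M" 56)
  | MAnd "('p, 'c) mfm" "('p, 'c) mfm" (infixr "\<and>\<^sub>M" 58)
  | MOr "('p, 'c) mfm" "('p, 'c) mfm" (infixr "\<or>\<^sub>M" 57)
  | MNeg "('p, 'c) mfm" ("\<sim>\<^sub>M _" [60] 60)
  | MBox "('p, 'c) mfm" ("\<box>_" [60] 60)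
  | MDia "('p, 'c) mfm" ("\<diamond>_" [60] 60)
  | MAll nat "('p, 'c) mfm"
  | MEx nat "('p, 'c) mfm"

abbreviation MNot :: "('p, 'c) mfm \<Rightarrow> ('p, 'c) mfm" ("\<not>\<^sub>M _" [60] 60) where
  "\<not>\<^sub>M \<Phi> \<equiv> \<Phi> \<rightarrow>\<^sub>M \<bottom>\<^sub>M"

abbreviation MIff :: "('p, 'c) mfm \<Rightarrow> ('p, 'c) mfm \<Rightarrow> ('p, 'c) mfm" (infix "\<leftrightarrow>\<^sub>M" 55) where
  "\<Phi> \<leftrightarrow>\<^sub>M \<Psi> \<equiv> (\<Phi> \<rightarrow>\<^sub>M \<Psi>) \<and>\<^sub>M (\<Psi> \<rightarrow>\<^sub>M \<Phi>)"

abbreviation MSIff :: "('p, 'c) mfm \<Rightarrow> ('p, 'c) mfm \<Rightarrow> ('p, 'c) mfm" (infix "\<Leftrightarrow>\<^sub>M" 55) where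
  "\<Phi> \<Leftrightarrow>\<^sub>M \<Psi> \<equiv> (\<Phi> \<leftrightarrow>\<^sub>M \<Psi>) \<and>\<^sub>M ((\<sim>\<^sub>M \<Phi>) \<leftrightarrow>\<^sub>M (\<sim>\<^sub>M \<Psi>))"

primrec mfm_wf :: "('p, 'c) signature \<Rightarrow> ('p, 'c) mfm \<Rightarrow> bool" where
  "mfm_wf \<sigma> (MAtom P ts) \<longleftrightarrow> P \<in> preds \<sigma> \<and> length ts = arity \<sigma> P \<and> (\<forall>t\<in>set ts. tm_wf \<sigma> t)"
| "mfm_wf \<sigma> \<bottom>\<^sub>M \<longleftrightarrow> True"
| "mfm_wf \<sigma> (\<Phi> \<rightarrow>\<^sub>M \<Psi>) \<longleftrightarrow> mfm_wf \<sigma> \<Phi> \<and> mfm_wf \<sigma> \<Psi>"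
| "mfm_wf \<sigma> (\<Phi> \<and>\<^sub>M \<Psi>) \<longleftrightarrow> mfm_wf \<sigma> \<Phi> \<and> mfm_wf \<sigma> \<Psi>"
| "mfm_wf \<sigma> (\<Phi> \<or>\<^sub>M \<Psi>) \<longleftrightarrow> mfm_wf \<sigma> \<Phi> \<and> mfm_wf \<sigma> \<Psi>"
| "mfm_wf \<sigma> (\<sim>\<^sub>M \<Phi>) \<longleftrightarrow> mfm_wf \<sigma> \<Phi>"
| "mfm_wf \<sigma> (\<box>\<Phi>) \<longleftrightarrow> mfm_wf \<sigma> \<Phi>"
| "mfm_wf \<sigma> (\<diamond>\<Phi>) \<longleftrightarrow> mfm_wf \<sigma> \<Phi>"
| "mfm_wf \<sigma> (MAll x \<Phi>) \<longleftrightarrow> mfm_wf \<sigma> \<Phi>"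
| "mfm_wf \<sigma> (MEx x \<Phi>) \<longleftrightarrow> mfm_wf \<sigma> \<Phi>"

primrec mfm_fv :: "('p, 'c) mfm \<Rightarrow> nat set" where
  "mfm_fv (MAtom P ts) = (\<Union>t\<in>set ts. tm_vars t)"
| "mfm_fv \<bottom>\<^sub>M = {}"
| "mfm_fv (\<Phi> \<rightarrow>\<^sub>M \<Psi>) = mfm_fv \<Phi> \<union> mfm_fv \<Psi>"
| "mfm_fv (\<Phi> \<and>\<^sub>M \<Psi>) = mfm_fv \<Phi> \<union> mfm_fv \<Psi>"
| "mfm_fv (\<Phi> \<or>\<^sub>M \<Psi>) = mfm_fv \<Phi> \<union> mfm_fv \<Psi>"
| "mfm_fv (\<sim>\<^sub>M \<Phi>) = mfm_fv \<Phi>"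
| "mfm_fv (\<box>\<Phi>) = mfm_fv \<Phi>"
| "mfm_fv (\<diamond>\<Phi>) = mfm_fv \<Phi>"
| "mfm_fv (MAll x \<Phi>) = mfm_fv \<Phi> - {x}"
| "mfm_fv (MEx x \<Phi>) = mfm_fv \<Phi> - {x}"

primrec mfm_subst :: "nat \<Rightarrow> 'c tm \<Rightarrow> ('p, 'c) mfm \<Rightarrow> ('p, 'c) mfm" where
  "mfm_subst x t (MAtom P ts) = MAtom P (map (tm_subst x t) ts)"
| "mfm_subst x t \<bottom>\<^sub>M = \<bottom>\<^sub>M"
| "mfm_subst x t (\<Phi> \<rightarrow>\<^sub>M \<Psi>) = mfm_subst x t \<Phi> \<rightarrow>\<^sub>M mfm_subst x t \<Psi>"
| "mfm_subst x t (\<Phi> \<and>\<^sub>M \<Psi>) = mfm_subst x t \<Phi> \<and>\<^sub>M mfm_subst x t \<Psi>"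
| "mfm_subst x t (\<Phi> \<or>\<^sub>M \<Psi>) = mfm_subst x t \<Phi> \<or>\<^sub>M mfm_subst x t \<Psi>"
| "mfm_subst x t (\<sim>\<^sub>M \<Phi>) = \<sim>\<^sub>M (mfm_subst x t \<Phi>)"
| "mfm_subst x t (\<box>\<Phi>) = \<box>(mfm_subst x t \<Phi>)"
| "mfm_subst x t (\<diamond>\<Phi>) = \<diamond>(mfm_subst x t \<Phi>)"
| "mfm_subst x t (MAll y \<Phi>) = MAll y (if y = x then \<Phi> else mfm_subst x t \<Phi>)"
| "mfm_subst x t (MEx y \<Phi>) = MEx y (if y = x then \<Phi> else mfm_subst x t \<Phi>)"

primrec mfm_free_for :: "'c tm \<Rightarrow> nat \<Rightarrow> ('p, 'c) mfm \<Rightarrow> bool" where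
  "mfm_free_for t x (MAtom P ts) \<longleftrightarrow> True"
| "mfm_free_for t x \<bottom>\<^sub>M \<longleftrightarrow> True"
| "mfm_free_for t x (\<Phi> \<rightarrow>\<^sub>M \<Psi>) \<longleftrightarrow> mfm_free_for t x \<Phi> \<and> mfm_free_for t x \<Psi>"
| "mfm_free_for t x (\<Phi> \<and>\<^sub>M \<Psi>) \<longleftrightarrow> mfm_free_for t x \<Phi> \<and> mfm_free_for t x \<Psi>"
| "mfm_free_for t x (\<Phi> \<or>\<^sub>M \<Psi>) \<longleftrightarrow> mfm_free_for t x \<Phi> \<and> mfm_free_for t x \<Psi>"
| "mfm_free_for t x (\<sim>\<^sub>M \<Phi>) \<longleftrightarrow> mfm_free_for t x \<Phi>"
| "mfm_free_for t x (\<box>\<Phi>) \<longleftrightarrow> mfm_free_for t x \<Phi>"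
| "mfm_free_for t x (\<diamond>\<Phi>) \<longleftrightarrow> mfm_free_for t x \<Phi>"
| "mfm_free_for t x (MAll y \<Phi>) \<longleftrightarrow>
     x \<notin> mfm_fv (MAll y \<Phi>) \<or> (y \<notin> tm_vars t \<and> mfm_free_for t x \<Phi>)"
| "mfm_free_for t x (MEx y \<Phi>) \<longleftrightarrow>
     x \<notin> mfm_fv (MEx y \<Phi>) \<or> (y \<notin> tm_vars t \<and> mfm_free_for t x \<Phi>)"


section \<open>The logics \<open>QBK\<close>, \<open>QBS4\<close> and \<open>QB3S4\<close>\<close>

inductive_set QBK_axioms :: "('p, 'c) mfm set" where
  imp_K: "\<Phi> \<rightarrow>\<^sub>M (\<Psi> \<rightarrow>\<^sub>M \<Phi>) \<in> QBK_axioms"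
| imp_S: "(\<Phi> \<rightarrow>\<^sub>M (\<Psi> \<rightarrow>\<^sub>M \<Theta>)) \<rightarrow>\<^sub>M ((\<Phi> \<rightarrow>\<^sub>M \<Psi>) \<rightarrow>\<^sub>M (\<Phi> \<rightarrow>\<^sub>M \<Theta>)) \<in> QBK_axioms"
| and_elim1: "(\<Phi> \<and>\<^sub>M \<Psi>) \<rightarrow>\<^sub>M \<Phi> \<in> QBK_axioms"
| and_elim2: "(\<Phi> \<and>\<^sub>M \<Psi>) \<rightarrow>\<^sub>M \<Psi> \<in> QBK_axioms"
| and_intro: "\<Phi> \<rightarrow>\<^sub>M (\<Psi> \<rightarrow>\<^sub>M (\<Phi> \<and>\<^sub>M \<Psi>)) \<in> QBK_axioms"
| or_intro1: "\<Phi> \<rightarrow>\<^sub>M (\<Phi> \<or>\<^sub>M \<Psi>) \<in> QBK_axioms"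
| or_intro2: "\<Psi> \<rightarrow>\<^sub>M (\<Phi> \<or>\<^sub>M \<Psi>) \<in> QBK_axioms"
| or_elim: "(\<Phi> \<rightarrow>\<^sub>M \<Theta>) \<rightarrow>\<^sub>M ((\<Psi> \<rightarrow>\<^sub>M \<Theta>) \<rightarrow>\<^sub>M ((\<Phi> \<or>\<^sub>M \<Psi>) \<rightarrow>\<^sub>M \<Theta>)) \<in> QBK_axioms"
| ex_falso: "\<bottom>\<^sub>M \<rightarrow>\<^sub>M \<Phi> \<in> QBK_axioms"
| excluded_middle: "\<Phi> \<or>\<^sub>M (\<not>\<^sub>M \<Phi>) \<in> QBK_axioms"
| neg_neg: "(\<sim>\<^sub>M \<sim>\<^sub>M \<Phi>) \<leftrightarrow>\<^sub>M \<Phi> \<in> QBK_axioms"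
| neg_imp: "(\<sim>\<^sub>M (\<Phi> \<rightarrow>\<^sub>M \<Psi>)) \<leftrightarrow>\<^sub>M (\<Phi> \<and>\<^sub>M \<sim>\<^sub>M \<Psi>) \<in> QBK_axioms"
| neg_and: "(\<sim>\<^sub>M (\<Phi> \<and>\<^sub>M \<Psi>)) \<leftrightarrow>\<^sub>M (\<sim>\<^sub>M \<Phi> \<or>\<^sub>M \<sim>\<^sub>M \<Psi>) \<in> QBK_axioms"
| neg_or: "(\<sim>\<^sub>M (\<Phi> \<or>\<^sub>M \<Psi>)) \<leftrightarrow>\<^sub>M (\<sim>\<^sub>M \<Phi> \<and>\<^sub>M \<sim>\<^sub>M \<Psi>) \<in> QBK_axioms"
| neg_bot: "\<sim>\<^sub>M \<bottom>\<^sub>M \<in> QBK_axioms"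
| box_and: "(\<box>\<Phi> \<and>\<^sub>M \<box>\<Psi>) \<rightarrow>\<^sub>M \<box>(\<Phi> \<and>\<^sub>M \<Psi>) \<in> QBK_axioms"
| box_imp_refl: "\<box>(\<Phi> \<rightarrow>\<^sub>M \<Phi>) \<in> QBK_axioms"
| not_box: "(\<not>\<^sub>M \<box>\<Phi>) \<leftrightarrow>\<^sub>M \<diamond>(\<not>\<^sub>M \<Phi>) \<in> QBK_axioms"
| not_dia: "(\<not>\<^sub>M \<diamond>\<Phi>) \<leftrightarrow>\<^sub>M \<box>(\<not>\<^sub>M \<Phi>) \<in> QBK_axioms"
| box_strong_dual: "\<box>\<Phi> \<Leftrightarrow>\<^sub>M (\<sim>\<^sub>M \<diamond>(\<sim>\<^sub>M \<Phi>)) \<in> QBK_axioms"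
| dia_strong_dual: "\<diamond>\<Phi> \<Leftrightarrow>\<^sub>M (\<sim>\<^sub>M \<box>(\<sim>\<^sub>M \<Phi>)) \<in> QBK_axioms"
| all_inst: "mfm_free_for t x \<Phi> \<Longrightarrow> MAll x \<Phi> \<rightarrow>\<^sub>M mfm_subst x t \<Phi> \<in> QBK_axioms"
| ex_inst: "mfm_free_for t x \<Phi> \<Longrightarrow> mfm_subst x t \<Phi> \<rightarrow>\<^sub>M MEx x \<Phi> \<in> QBK_axioms"
| neg_all: "(\<sim>\<^sub>M (MAll x \<Phi>)) \<leftrightarrow>\<^sub>M MEx x (\<sim>\<^sub>M \<Phi>) \<in> QBK_axioms"
| neg_ex: "(\<sim>\<^sub>M (MEx x \<Phi>)) \<leftrightarrow>\<^sub>M MAll x (\<sim>\<^sub>M \<Phi>) \<in> QBK_axioms"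

inductive_set QBK_ext ::
  "('p, 'c) signature \<Rightarrow> ('p, 'c) mfm set \<Rightarrow> ('p, 'c) mfm set"
  for \<sigma> :: "('p, 'c) signature" and Ax :: "('p, 'c) mfm set" where
  ax: "\<Phi> \<in> QBK_axioms \<union> Ax \<Longrightarrow> mfm_wf \<sigma> \<Phi> \<Longrightarrow> \<Phi> \<in> QBK_ext \<sigma> Ax"
| mp: "\<Phi> \<in> QBK_ext \<sigma> Ax \<Longrightarrow> \<Phi> \<rightarrow>\<^sub>M \<Psi> \<in> QBK_ext \<sigma> Ax \<Longrightarrow> \<Psi> \<in> QBK_ext \<sigma> Ax"
| mono_box: "\<Phi> \<rightarrow>\<^sub>M \<Psi> \<in> QBK_ext \<sigma> Ax \<Longrightarrow> \<box>\<Phi> \<rightarrow>\<^sub>M \<box>\<Psi> \<in> QBK_ext \<sigma> Ax"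
| mono_dia: "\<Phi> \<rightarrow>\<^sub>M \<Psi> \<in> QBK_ext \<sigma> Ax \<Longrightarrow> \<diamond>\<Phi> \<rightarrow>\<^sub>M \<diamond>\<Psi> \<in> QBK_ext \<sigma> Ax"
| bernays_all: "\<Phi> \<rightarrow>\<^sub>M \<Psi> \<in> QBK_ext \<sigma> Ax \<Longrightarrow> x \<notin> mfm_fv \<Phi> \<Longrightarrow>
    \<Phi> \<rightarrow>\<^sub>M MAll x \<Psi> \<in> QBK_ext \<sigma> Ax"
| bernays_ex: "\<Phi> \<rightarrow>\<^sub>M \<Psi> \<in> QBK_ext \<sigma> Ax \<Longrightarrow> x \<notin> mfm_fv \<Psi> \<Longrightarrow>
    MEx x \<Phi> \<rightarrow>\<^sub>M \<Psi> \<in> QBK_ext \<sigma> Ax"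

definition QBK :: "('p, 'c) signature \<Rightarrow> ('p, 'c) mfm set" where
  "QBK \<sigma> = QBK_ext \<sigma> {}"

text \<open>
  The schemes below make the extension of \<open>QBK\<close> complete for the expanding-domain models whose
  accessibility relation is a preorder.
\<close>

definition S4_axioms :: "('p, 'c) mfm set" where
  "S4_axioms = {\<box>\<Phi> \<rightarrow>\<^sub>M \<Phi> | \<Phi>. True} \<union> {\<box>\<Phi> \<rightarrow>\<^sub>M \<box>\<box>\<Phi> | \<Phi>. True}"

definition QBS4 :: "('p, 'c) signature \<Rightarrow> ('p, 'c) mfm set" where
  "QBS4 \<sigma> = QBK_ext \<sigma> S4_axioms"

definition QB3S4 :: "('p, 'c) signature \<Rightarrow> ('p, 'c) mfm set" where
  "QB3S4 \<sigma> = QBK_ext \<sigma> (S4_axioms \<union> {\<sim>\<^sub>M \<Phi> \<rightarrow>\<^sub>M (\<Phi> \<rightarrow>\<^sub>M \<Psi>) | \<Phi> \<Psi>. True})"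


section \<open>The translation\<close>

text \<open>
  Defined only on formulas in negative normal form (unspecified elsewhere). The formula
  \<open>\<sim>\<bottom>\<close>, which is in negative normal form, is left unchanged, just like \<open>\<bottom>\<close>.
\<close>

fun \<tau> :: "('p, 'c) nfm \<Rightarrow> ('p, 'c) mfm" where
  "\<tau> (NAtom P ts) = \<box>(MAtom P ts)"
| "\<tau> (\<sim>\<^sub>N (NAtom P ts)) = \<sim>\<^sub>M \<diamond>(MAtom P ts)"
| "\<tau> (\<Phi> \<or>\<^sub>N \<Psi>) = \<tau> \<Phi> \<or>\<^sub>M \<tau> \<Psi>"
| "\<tau> (\<Phi> \<and>\<^sub>N \<Psi>) = \<tau> \<Phi> \<and>\<^sub>M \<tau> \<Psi>"
| "\<tau> (\<Phi> \<rightarrow>\<^sub>N \<Psi>) = \<box>(\<tau> \<Phi> \<rightarrow>\<^sub>M \<tau> \<Psi>)"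
| "\<tau> \<bottom>\<^sub>N = \<bottom>\<^sub>M"
| "\<tau> (\<sim>\<^sub>N \<bottom>\<^sub>N) = \<sim>\<^sub>M \<bottom>\<^sub>M"
| "\<tau> (NEx x \<Phi>) = MEx x (\<tau> \<Phi>)"
| "\<tau> (NAll x \<Phi>) = \<box>(MAll x (\<tau> \<Phi>))"

end

theory Submission
  imports Defs
begin

text \<open>
  From left to right, the translation is extended to all formulas by pushing strong negation
  inwards; its values imply their own necessitation, so that a derivation in Nelson's logic is
  translated rule by rule.

  From right to left, no Henkin construction is needed. Call a pair \<open>(\<phi>, \<theta>)\<close> with
  \<open>\<phi> \<turnstile> \<theta>\<close> underivable in Nelson's logic a condition, ordered by derivability of the first
  component for a fixed second one. The regular sets of conditions form a complete Boolean algebra,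
  and \<open>\<chi> \<mapsto> {(\<phi>, \<theta>). \<phi>, \<chi> \<rightarrow> \<theta> \<turnstile> \<theta>}\<close> embeds the Lindenbaum algebra into it (for each \<open>\<theta>\<close> one
  takes the quotient by double negation relative to \<open>\<theta>\<close>), preserving finite meets, finite joins and
  the joins given by \<open>\<exists>\<close>. Joining the embedded elements below a given one defines an
  interior operator \<open>\<box>\<close>, for which implication and \<open>\<forall>\<close> of Nelson's logic become \<open>\<box>\<close> of the Boolean
  ones. Pairs of values for verification and falsification yield a model of \<open>QBS4\<close> with a
  constant domain of terms, in which \<open>\<tau> \<Phi>\<close> is valid only if \<open>\<Phi>\<close> is derivable; the Barcan formula
  does not get in the way, because \<open>\<box>\<close> need not preserve infinite meets.
\<close>

section \<open>Natural deduction in intuitionistic Hilbert calculi\<close>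

text \<open>Abstract because it is instantiated twice, by the modal logics and by Nelson's logics.
  The predicate \<open>wff\<close> records that theorems stay inside the signature.\<close>

locale int_calculus =
  fixes wff :: "'f \<Rightarrow> bool" and imp con dis :: "'f \<Rightarrow> 'f \<Rightarrow> 'f" and fls :: 'f and L :: "'f set"
  assumes L_wff: "\<phi> \<in> L \<Longrightarrow> wff \<phi>"
    and wff_imp: "wff (imp \<phi> \<psi>) \<longleftrightarrow> wff \<phi> \<and> wff \<psi>"
    and wff_con: "wff (con \<phi> \<psi>) \<longleftrightarrow> wff \<phi> \<and> wff \<psi>"
    and wff_dis: "wff (dis \<phi> \<psi>) \<longleftrightarrow> wff \<phi> \<and> wff \<psi>"
    and wff_fls: "wff fls"
    and ax_K: "wff \<phi> \<Longrightarrow> wff \<psi> \<Longrightarrow> imp \<phi> (imp \<psi> \<phi>) \<in> L"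
    and ax_S: "wff \<phi> \<Longrightarrow> wff \<psi> \<Longrightarrow> wff \<theta> \<Longrightarrow>
      imp (imp \<phi> (imp \<psi> \<theta>)) (imp (imp \<phi> \<psi>) (imp \<phi> \<theta>)) \<in> L"
    and ax_con_elim1: "wff \<phi> \<Longrightarrow> wff \<psi> \<Longrightarrow> imp (con \<phi> \<psi>) \<phi> \<in> L"
    and ax_con_elim2: "wff \<phi> \<Longrightarrow> wff \<psi> \<Longrightarrow> imp (con \<phi> \<psi>) \<psi> \<in> L"
    and ax_con_intro: "wff \<phi> \<Longrightarrow> wff \<psi> \<Longrightarrow> imp \<phi> (imp \<psi> (con \<phi> \<psi>)) \<in> L"
    and ax_dis_intro1: "wff \<phi> \<Longrightarrow> wff \<psi> \<Longrightarrow> imp \<phi> (dis \<phi> \<psi>) \<in> L"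
    and ax_dis_intro2: "wff \<phi> \<Longrightarrow> wff \<psi> \<Longrightarrow> imp \<psi> (dis \<phi> \<psi>) \<in> L"
    and ax_dis_elim: "wff \<phi> \<Longrightarrow> wff \<psi> \<Longrightarrow> wff \<theta> \<Longrightarrow>
      imp (imp \<phi> \<theta>) (imp (imp \<psi> \<theta>) (imp (dis \<phi> \<psi>) \<theta>)) \<in> L"
    and ax_fls: "wff \<phi> \<Longrightarrow> imp fls \<phi> \<in> L"
    and L_mp: "\<phi> \<in> L \<Longrightarrow> imp \<phi> \<psi> \<in> L \<Longrightarrow> \<psi> \<in> L"
begin

lemmas wff_simps [simp] = wff_imp wff_con wff_dis wff_fls

text \<open>Modus ponens is the only rule applicable to hypotheses; all other rules of a calculus
  enter solely through members of \<open>L\<close>. For this reason the deduction theorem below has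
  no side conditions on variables or boxes.\<close>

inductive nd :: "'f set \<Rightarrow> 'f \<Rightarrow> bool" (infix "\<tturnstile>" 50) for \<Gamma> where
  ax: "\<phi> \<in> L \<Longrightarrow> \<Gamma> \<tturnstile> \<phi>"
| hyp: "\<phi> \<in> \<Gamma> \<Longrightarrow> wff \<phi> \<Longrightarrow> \<Gamma> \<tturnstile> \<phi>"
| impE: "\<Gamma> \<tturnstile> \<phi> \<Longrightarrow> \<Gamma> \<tturnstile> imp \<phi> \<psi> \<Longrightarrow> \<Gamma> \<tturnstile> \<psi>"

lemma nd_wff: "\<Gamma> \<tturnstile> \<phi> \<Longrightarrow> wff \<phi>"
  by (induction rule: nd.induct) (auto dest: L_wff)

lemma nd_mono: "\<Gamma> \<tturnstile> \<phi> \<Longrightarrow> \<Gamma> \<subseteq> \<Delta> \<Longrightarrow> \<Delta> \<tturnstile> \<phi>"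
  by (induction rule: nd.induct) (auto intro: nd.intros)

lemma impI:
  assumes "insert \<phi> \<Gamma> \<tturnstile> \<psi>" "wff \<phi>"
  shows "\<Gamma> \<tturnstile> imp \<phi> \<psi>"
  using assms(1)
proof (induction rule: nd.induct)
  case (ax \<psi>)
  then show ?case using ax_K[of \<psi> \<phi>] assms(2) L_wff by (blast intro: nd.intros)
next
  case (hyp \<psi>)
  have "\<Gamma> \<tturnstile> imp \<phi> \<phi>"
    using ax_K[of \<phi> \<phi>] ax_K[of \<phi> "imp \<phi> \<phi>"] ax_S[of \<phi> "imp \<phi> \<phi>" \<phi>] assms(2)
    by (auto intro: nd.ax L_mp)
  moreover have "\<Gamma> \<tturnstile> imp \<phi> \<psi>" if "\<psi> \<in> \<Gamma>"
    using ax_K[of \<psi> \<phi>] assms(2) hyp that by (blast intro: nd.intros)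
  ultimately show ?case using hyp by auto
next
  case (impE \<psi> \<theta>)
  have "wff \<psi> \<and> wff \<theta>" using impE(2) nd_wff[of _ "imp \<psi> \<theta>"] by auto
  then show ?case
    using ax_S[of \<phi> \<psi> \<theta>] impE(3,4) assms(2) by (blast intro: nd.intros)
qed

lemma cut: "\<Gamma> \<tturnstile> \<phi> \<Longrightarrow> insert \<phi> \<Gamma> \<tturnstile> \<psi> \<Longrightarrow> \<Gamma> \<tturnstile> \<psi>"
  by (rule impE[OF _ impI]) (auto dest: nd_wff)

lemma conI: "\<Gamma> \<tturnstile> \<phi> \<Longrightarrow> \<Gamma> \<tturnstile> \<psi> \<Longrightarrow> \<Gamma> \<tturnstile> con \<phi> \<psi>"
  by (meson ax_con_intro nd.intros nd_wff)

lemma conE1: "\<Gamma> \<tturnstile> con \<phi> \<psi> \<Longrightarrow> \<Gamma> \<tturnstile> \<phi>"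
  by (meson ax_con_elim1 nd.intros nd_wff wff_con)

lemma conE2: "\<Gamma> \<tturnstile> con \<phi> \<psi> \<Longrightarrow> \<Gamma> \<tturnstile> \<psi>"
  by (meson ax_con_elim2 nd.intros nd_wff wff_con)

lemma disI1: "\<Gamma> \<tturnstile> \<phi> \<Longrightarrow> wff \<psi> \<Longrightarrow> \<Gamma> \<tturnstile> dis \<phi> \<psi>"
  by (meson ax_dis_intro1 nd.intros nd_wff)

lemma disI2: "\<Gamma> \<tturnstile> \<psi> \<Longrightarrow> wff \<phi> \<Longrightarrow> \<Gamma> \<tturnstile> dis \<phi> \<psi>"
  by (meson ax_dis_intro2 nd.intros nd_wff)

lemma disE:
  assumes "\<Gamma> \<tturnstile> dis \<phi> \<psi>" "insert \<phi> \<Gamma> \<tturnstile> \<theta>" "insert \<psi> \<Gamma> \<tturnstile> \<theta>"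
  shows "\<Gamma> \<tturnstile> \<theta>"
proof -
  have w: "wff \<phi>" "wff \<psi>" "wff \<theta>" using nd_wff[OF assms(1)] nd_wff[OF assms(2)] by auto
  show ?thesis
    by (rule impE[OF assms(1) impE[OF impI[OF assms(3) w(2)]
          impE[OF impI[OF assms(2) w(1)] nd.ax[OF ax_dis_elim[OF w]]]]])
qed

lemma flsE: "\<Gamma> \<tturnstile> fls \<Longrightarrow> wff \<phi> \<Longrightarrow> \<Gamma> \<tturnstile> \<phi>"
  by (meson ax_fls nd.intros)

lemma nd_empty_iff: "{} \<tturnstile> \<phi> \<longleftrightarrow> \<phi> \<in> L"
proof
  show "{} \<tturnstile> \<phi> \<Longrightarrow> \<phi> \<in> L"
    by (induction rule: nd.induct) (auto intro: L_mp)
qed (rule nd.ax)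

text \<open>Bernays' rules and the monotonicity rules act on theorems that are implications. This
  equivalence moves a derivation from one hypothesis into \<open>L\<close>, where such a rule can be
  applied, and back.\<close>

lemma imp_in_L_iff: "imp \<phi> \<psi> \<in> L \<longleftrightarrow> wff \<phi> \<and> {\<phi>} \<tturnstile> \<psi>"
proof
  assume "imp \<phi> \<psi> \<in> L"
  then show "wff \<phi> \<and> {\<phi>} \<tturnstile> \<psi>"
    using L_wff[of "imp \<phi> \<psi>"] by (auto intro: nd.intros)
next
  assume "wff \<phi> \<and> {\<phi>} \<tturnstile> \<psi>"
  then show "imp \<phi> \<psi> \<in> L" using impI[of \<phi> "{}"] nd_empty_iff by auto
qed

lemma impD: "\<Gamma> \<tturnstile> imp \<phi> \<psi> \<Longrightarrow> insert \<phi> \<Gamma> \<tturnstile> \<psi>"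
  by (rule impE[OF hyp nd_mono]) (auto dest: nd_wff)

lemma nd_trans: "{\<phi>} \<tturnstile> \<psi> \<Longrightarrow> {\<psi>} \<tturnstile> \<theta> \<Longrightarrow> {\<phi>} \<tturnstile> \<theta>"
  by (rule cut[OF _ nd_mono]) auto

text \<open>Packs hypotheses into one formula, so that a forcing condition needs only a single
  formula as its first component.\<close>

lemma nd_con_left: "insert (con \<phi> \<psi>) \<Gamma> \<tturnstile> \<theta> \<longleftrightarrow> insert \<phi> (insert \<psi> \<Gamma>) \<tturnstile> \<theta>"
  if "wff \<phi>" "wff \<psi>"
proof
  let ?\<Delta> = "insert \<phi> (insert \<psi> \<Gamma>)"
  assume "insert (con \<phi> \<psi>) \<Gamma> \<tturnstile> \<theta>"
  then have "insert (con \<phi> \<psi>) ?\<Delta> \<tturnstile> \<theta>" by (rule nd_mono) auto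
  moreover have "?\<Delta> \<tturnstile> con \<phi> \<psi>" using that by (intro conI nd.hyp) auto
  ultimately show "?\<Delta> \<tturnstile> \<theta>" by (rule cut[rotated])
next
  let ?\<Delta> = "insert (con \<phi> \<psi>) \<Gamma>"
  assume "insert \<phi> (insert \<psi> \<Gamma>) \<tturnstile> \<theta>"
  then have *: "insert \<phi> (insert \<psi> ?\<Delta>) \<tturnstile> \<theta>" by (rule nd_mono) auto
  have c: "?\<Delta> \<tturnstile> con \<phi> \<psi>" using that by (intro nd.hyp) auto
  have "insert \<psi> ?\<Delta> \<tturnstile> \<phi>" using conE1[OF c] by (rule nd_mono) auto
  then show "?\<Delta> \<tturnstile> \<theta>" by (intro cut[OF conE2[OF c]] cut[OF _ *])
qed

lemma nd_refl: "wff \<phi> \<Longrightarrow> {\<phi>} \<tturnstile> \<phi>"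
  by (rule hyp) auto

lemma cut_left: "{\<phi>'} \<tturnstile> \<phi> \<Longrightarrow> insert \<phi> \<Gamma> \<tturnstile> \<theta> \<Longrightarrow> insert \<phi>' \<Gamma> \<tturnstile> \<theta>"
  by (rule cut[of _ \<phi>]) (auto elim: nd_mono)

lemma hyp_mp: "\<phi> \<in> \<Gamma> \<Longrightarrow> imp \<phi> \<psi> \<in> \<Gamma> \<Longrightarrow> wff \<phi> \<Longrightarrow> wff \<psi> \<Longrightarrow> \<Gamma> \<tturnstile> \<psi>"
  by (rule impE[OF hyp hyp]) auto

lemma nd_subst: "\<Delta> \<tturnstile> \<phi> \<Longrightarrow> (\<And>\<delta>. \<delta> \<in> \<Delta> \<Longrightarrow> \<Gamma> \<tturnstile> \<delta>) \<Longrightarrow> \<Gamma> \<tturnstile> \<phi>"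
  by (induction rule: nd.induct) (auto intro: nd.intros)

end

section \<open>Regular sets of forcing conditions\<close>

locale forcing =
  fixes X :: "'x set" and le :: "'x \<Rightarrow> 'x \<Rightarrow> bool"
  assumes le_refl: "p \<in> X \<Longrightarrow> le p p"
    and le_trans: "p \<in> X \<Longrightarrow> q \<in> X \<Longrightarrow> r \<in> X \<Longrightarrow> le r q \<Longrightarrow> le q p \<Longrightarrow> le r p"
begin

text \<open>The points below which \<open>U\<close> is dense. On downsets this is double negation in
  the Heyting algebra of downsets, so its fixed points form a complete Boolean algebra with joins
  given by \<open>reg\<close> of the union.\<close>

definition reg :: "'x set \<Rightarrow> 'x set" where
  "reg U = {p \<in> X. \<forall>q\<in>X. le q p \<longrightarrow> (\<exists>r\<in>X. le r q \<and> r \<in> U)}"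

definition downset :: "'x set \<Rightarrow> bool" where
  "downset U \<longleftrightarrow> U \<subseteq> X \<and> (\<forall>p\<in>U. \<forall>q\<in>X. le q p \<longrightarrow> q \<in> U)"

definition regular :: "'x set \<Rightarrow> bool" where
  "regular U \<longleftrightarrow> downset U \<and> reg U \<subseteq> U"

text \<open>Heyting implication of downsets; \<open>himp U {}\<close> is the
  pseudocomplement.\<close>

definition himp :: "'x set \<Rightarrow> 'x set \<Rightarrow> 'x set" where
  "himp U V = {p \<in> X. \<forall>q\<in>X. le q p \<longrightarrow> q \<in> U \<longrightarrow> q \<in> V}"

lemma downset_reg: "downset (reg U)"
  unfolding downset_def reg_def using le_trans by blast

lemma regular_reg: "regular (reg U)"
  unfolding regular_def
proof (intro conjI downset_reg subsetI)
  fix p assume p: "p \<in> reg (reg U)"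
  have "\<exists>s\<in>X. le s q \<and> s \<in> U" if q: "q \<in> X" "le q p" for q
  proof -
    obtain r where r: "r \<in> X" "le r q" "r \<in> reg U" using p q unfolding reg_def by blast
    then obtain s where "s \<in> X" "le s r" "s \<in> U" using le_refl unfolding reg_def by blast
    then show ?thesis using r q le_trans by blast
  qed
  then show "p \<in> reg U" using p unfolding reg_def by blast
qed

lemma reg_upper: "downset U \<Longrightarrow> U \<subseteq> reg U"
  unfolding downset_def reg_def using le_refl by blast

lemma reg_mono: "U \<subseteq> V \<Longrightarrow> reg U \<subseteq> reg V"
  unfolding reg_def by blast

lemma reg_least: "U \<subseteq> V \<Longrightarrow> regular V \<Longrightarrow> reg U \<subseteq> V"
  using reg_mono unfolding regular_def by blast

lemma reg_eq: "regular U \<Longrightarrow> reg U = U"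
  using reg_upper unfolding regular_def by blast

lemma regular_downset: "regular U \<Longrightarrow> downset U"
  unfolding regular_def by blast

lemma regular_subset: "regular U \<Longrightarrow> U \<subseteq> X"
  unfolding regular_def downset_def by blast

lemma regular_empty: "regular {}"
  unfolding regular_def downset_def reg_def using le_refl by blast

lemma regular_X: "regular X"
  unfolding regular_def downset_def reg_def by blast

lemma downset_Un: "downset U \<Longrightarrow> downset V \<Longrightarrow> downset (U \<union> V)"
  unfolding downset_def by blast

lemma downset_UN: "(\<And>i. i \<in> I \<Longrightarrow> downset (U i)) \<Longrightarrow> downset (\<Union>i\<in>I. U i)"
  unfolding downset_def by blast

lemma regular_INT:
  assumes "\<And>i. i \<in> I \<Longrightarrow> regular (U i)" "I \<noteq> {}"
  shows "regular (\<Inter>i\<in>I. U i)"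
proof -
  have "downset (\<Inter>i\<in>I. U i)"
    using assms unfolding regular_def downset_def by blast
  moreover have "reg (\<Inter>i\<in>I. U i) \<subseteq> U i" if "i \<in> I" for i
    by (rule reg_least) (use that assms in auto)
  ultimately show ?thesis unfolding regular_def by blast
qed

lemma regular_Int: "regular U \<Longrightarrow> regular V \<Longrightarrow> regular (U \<inter> V)"
  using regular_INT[of "{U, V}" "\<lambda>x. x"] by auto

lemma himp_mono: "U' \<subseteq> U \<Longrightarrow> V \<subseteq> V' \<Longrightarrow> himp U V \<subseteq> himp U' V'"
  unfolding himp_def by blast

text \<open>Let \<open>himp U V\<close> be dense below p, and let q below p lie in \<open>U\<close>.
  Every refinement of q has a further one in \<open>himp U V\<close>; it is still in the downset
  \<open>U\<close>, hence in \<open>V\<close>. So \<open>V\<close> is dense below q, and regularity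
  puts q into \<open>V\<close>.\<close>

lemma regular_himp:
  assumes "downset U" "regular V"
  shows "regular (himp U V)"
proof -
  have "downset (himp U V)"
    unfolding downset_def himp_def using le_trans by blast
  moreover have "q \<in> V" if "p \<in> reg (himp U V)" "q \<in> X" "le q p" "q \<in> U" for p q
  proof -
    have "\<exists>s\<in>X. le s r \<and> s \<in> V" if r: "r \<in> X" "le r q" for r
    proof -
      have "le r p" using r that \<open>le q p\<close> \<open>p \<in> reg _\<close> \<open>q \<in> X\<close> le_trans unfolding reg_def by blast
      then obtain s where s: "s \<in> X" "le s r" "s \<in> himp U V"
        using \<open>p \<in> reg _\<close> r unfolding reg_def by blast
      have "s \<in> U" using s r \<open>q \<in> U\<close> \<open>q \<in> X\<close> assms(1) unfolding downset_def by blast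
      then show ?thesis using s le_refl unfolding himp_def by blast
    qed
    then have "q \<in> reg V" using \<open>q \<in> X\<close> unfolding reg_def by blast
    then show ?thesis using assms(2) reg_eq by blast
  qed
  moreover have "reg (himp U V) \<subseteq> X" unfolding reg_def by blast
  ultimately show ?thesis unfolding regular_def himp_def by blast
qed

lemma subset_himp_iff:
  "downset W \<Longrightarrow> downset U \<Longrightarrow> W \<subseteq> himp U V \<longleftrightarrow> W \<inter> U \<subseteq> V"
  unfolding himp_def downset_def using le_refl by blast

lemma himp_eq_X_iff: "downset U \<Longrightarrow> himp U V = X \<longleftrightarrow> U \<subseteq> V"
  unfolding himp_def downset_def using le_refl by blast

text \<open>Unfolding the double pseudocomplement yields \<open>reg U\<close>, and regular sets are
  fixed by \<open>reg\<close>.\<close>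

lemma himp_empty_empty: "regular U \<Longrightarrow> himp (himp U {}) {} = U"
proof -
  assume U: "regular U"
  have "p \<in> himp (himp U {}) {} \<longleftrightarrow> p \<in> reg U" for p
    unfolding himp_def reg_def by blast
  then show ?thesis using reg_eq U by blast
qed

text \<open>Excluded middle: a point without refinement in \<open>U\<close> lies in the
  pseudocomplement of \<open>U\<close>.\<close>

lemma reg_Un_himp: "reg (U \<union> himp U {}) = X"
proof -
  have "\<exists>r\<in>X. le r q \<and> r \<in> U \<union> himp U {}" if "q \<in> X" for q
  proof (cases "\<exists>r\<in>X. le r q \<and> r \<in> U")
    case False
    then have "q \<in> himp U {}" using that unfolding himp_def by blast
    then show ?thesis using that le_refl by blast
  qed blast
  then show ?thesis unfolding reg_def by blast
qed

text \<open>Refine first into \<open>U\<close> and then into \<open>V\<close>; the second refinement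
  does not leave the downset \<open>U\<close>.\<close>

lemma reg_Int:
  assumes "downset U" "downset V"
  shows "reg U \<inter> reg V \<subseteq> reg (U \<inter> V)"
proof
  fix p assume p: "p \<in> reg U \<inter> reg V"
  have "\<exists>r\<in>X. le r q \<and> r \<in> U \<inter> V" if q: "q \<in> X" "le q p" for q
  proof -
    obtain r where r: "r \<in> X" "le r q" "r \<in> U" using p q unfolding reg_def by blast
    then have "le r p" using p q le_trans unfolding reg_def by blast
    then obtain s where s: "s \<in> X" "le s r" "s \<in> V" using p r unfolding reg_def by blast
    then have "s \<in> U" "le s q" using r q assms(1) le_trans unfolding downset_def by blast+
    then show ?thesis using s by blast
  qed
  then show "p \<in> reg (U \<inter> V)" using p unfolding reg_def by blast
qed

lemma downset_himp: "downset (himp U V)"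
  unfolding downset_def himp_def using le_trans by blast

lemma downset_Int: "downset U \<Longrightarrow> downset V \<Longrightarrow> downset (U \<inter> V)"
  unfolding downset_def by blast

lemma himp_self: "himp U U = X"
  unfolding himp_def by blast

lemma himp_mp: "himp U V \<inter> U \<subseteq> V"
  unfolding himp_def using le_refl by blast

lemma reg_disjoint:
  assumes "downset W" "U \<inter> W = {}"
  shows "reg U \<inter> W = {}"
proof -
  have False if p: "p \<in> reg U" "p \<in> W" for p
  proof -
    obtain r where "r \<in> X" "le r p" "r \<in> U" using p le_refl unfolding reg_def by blast
    then show False using p assms unfolding downset_def by blast
  qed
  then show ?thesis by blast
qed

end

text \<open>\<open>J\<close> generates the open elements. Closure under finite meets makes
  \<open>box\<close> preserve the top and binary meets; nothing is assumed about infinite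
  ones.\<close>

locale interior_forcing = forcing X le for X :: "'x set" and le +
  fixes J :: "'x set set"
  assumes J_regular: "U \<in> J \<Longrightarrow> regular U"
    and X_in_J: "X \<in> J"
    and J_Int: "U \<in> J \<Longrightarrow> V \<in> J \<Longrightarrow> U \<inter> V \<in> J"
begin

definition box :: "'x set \<Rightarrow> 'x set" where
  "box U = reg (\<Union>{V \<in> J. V \<subseteq> U})"

definition dia :: "'x set \<Rightarrow> 'x set" where
  "dia U = himp (box (himp U {})) {}"

lemma regular_box: "regular (box U)"
  unfolding box_def by (rule regular_reg)

lemma regular_dia: "regular (dia U)"
  unfolding dia_def by (intro regular_himp regular_downset regular_box regular_empty)

lemma downset_Union_J: "downset (\<Union>{V \<in> J. V \<subseteq> U})"
  using downset_UN[of "{V \<in> J. V \<subseteq> U}" "\<lambda>x. x"] J_regular regular_downset by auto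

lemma box_subset: "regular U \<Longrightarrow> box U \<subseteq> U"
  unfolding box_def by (rule reg_least) auto

lemma J_subset_box: "V \<in> J \<Longrightarrow> V \<subseteq> U \<Longrightarrow> V \<subseteq> box U"
  unfolding box_def using reg_upper[OF downset_Union_J] by blast

lemma box_J: "V \<in> J \<Longrightarrow> box V = V"
  using box_subset J_subset_box J_regular by blast

lemma box_mono: "U \<subseteq> V \<Longrightarrow> box U \<subseteq> box V"
  unfolding box_def by (rule reg_mono) auto

lemma dia_mono: "U \<subseteq> V \<Longrightarrow> dia U \<subseteq> dia V"
  unfolding dia_def by (intro himp_mono box_mono) auto

lemma box_X: "box X = X"
  using box_J X_in_J by blast

text \<open>A member of \<open>J\<close> below \<open>U\<close> is already below
  \<open>box U\<close>, so it also takes part in the join defining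
  \<open>box (box U)\<close>.\<close>

lemma box_subset_box_box: "box U \<subseteq> box (box U)"
proof -
  have "\<Union>{V \<in> J. V \<subseteq> U} \<subseteq> \<Union>{V \<in> J. V \<subseteq> box U}" using J_subset_box by blast
  then show ?thesis using reg_mono unfolding box_def by blast
qed

text \<open>Intersections of two generators are generators, and \<open>reg\<close> distributes over
  binary intersections of downsets.\<close>

lemma box_Int: "box U \<inter> box V \<subseteq> box (U \<inter> V)"
proof -
  have "\<Union>{W \<in> J. W \<subseteq> U} \<inter> \<Union>{W \<in> J. W \<subseteq> V} \<subseteq> \<Union>{W \<in> J. W \<subseteq> U \<inter> V}"
    using J_Int by blast
  then show ?thesis
    using reg_Int[OF downset_Union_J downset_Union_J, of U V] reg_mono unfolding box_def by blast
qed

text \<open>Disjointness puts \<open>U\<close> below the complement of \<open>V\<close>, and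
  \<open>dia V\<close> is the complement of the box of that complement. This serves the modal cases
  of the disjointness of verification and falsification.\<close>

lemma box_Int_dia_empty:
  assumes "regular U" "regular V" "U \<inter> V = {}"
  shows "box U \<inter> dia V = {}"
proof -
  have "U \<subseteq> himp V {}" using assms subset_himp_iff regular_downset by auto
  then have "box U \<subseteq> box (himp V {})" by (rule box_mono)
  then show ?thesis unfolding dia_def himp_def
    using le_refl regular_subset[OF regular_box] by blast
qed

end

section \<open>Embedding the Lindenbaum algebra\<close>

context int_calculus
begin

text \<open>The second component plays the role of falsity: the first one is consistent relative to
  it.\<close>

definition cond :: "('f \<times> 'f) set" where
  "cond = {(\<phi>, \<theta>). wff \<phi> \<and> wff \<theta> \<and> \<not> {\<phi>} \<tturnstile> \<theta>}"

definition ext :: "'f \<times> 'f \<Rightarrow> 'f \<times> 'f \<Rightarrow> bool" where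
  "ext q p \<longleftrightarrow> snd q = snd p \<and> {fst q} \<tturnstile> fst p"

text \<open>Here \<open>imp \<chi> \<theta>\<close> is the negation of \<chi> relative to \<theta>,
  so membership says that \<phi> derives the relative double negation of \<chi>.\<close>

definition emb :: "'f \<Rightarrow> ('f \<times> 'f) set" where
  "emb \<chi> = {(\<phi>, \<theta>) \<in> cond. {\<phi>, imp \<chi> \<theta>} \<tturnstile> \<theta>}"

sublocale can: forcing cond ext
proof
  show "ext p p" if "p \<in> cond" for p
    using that nd_refl unfolding cond_def ext_def by auto
  show "ext r p" if "ext r q" "ext q p" for p q r
    using that nd_trans unfolding ext_def by metis
qed

lemma regular_emb:
  assumes "wff \<chi>"
  shows "can.regular (emb \<chi>)"
  unfolding can.regular_def
proof (intro conjI subsetI)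
  show "can.downset (emb \<chi>)"
    unfolding can.downset_def emb_def ext_def using cut_left by auto
  fix p assume p: "p \<in> can.reg (emb \<chi>)"
  obtain \<phi> \<theta> where [simp]: "p = (\<phi>, \<theta>)" by (cases p)
  have p': "(\<phi>, \<theta>) \<in> cond" using p unfolding can.reg_def by auto
  then have w: "wff \<phi>" "wff \<theta>" unfolding cond_def by auto
  show "p \<in> emb \<chi>"
  proof (rule ccontr)
    assume "p \<notin> emb \<chi>"
    then have n: "\<not> {\<phi>, imp \<chi> \<theta>} \<tturnstile> \<theta>" using p' unfolding emb_def by auto
    \<comment> \<open>If (\<phi>, \<theta>) is outside \<open>emb \<chi>\<close>, adding the
      relative negation of \<chi> to \<phi> still gives a condition, and no extension of that
      condition can lie in \<open>emb \<chi>\<close>.\<close>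
    define \<psi> where "\<psi> = con \<phi> (imp \<chi> \<theta>)"
    have \<psi>: "{\<psi>} \<tturnstile> \<phi>" "{\<psi>} \<tturnstile> imp \<chi> \<theta>"
      unfolding \<psi>_def using assms w by (auto intro: hyp simp: nd_con_left)
    have "(\<psi>, \<theta>) \<in> cond" "ext (\<psi>, \<theta>) p"
      using n \<psi> w assms nd_con_left[of \<phi> "imp \<chi> \<theta>" "{}"]
      unfolding cond_def ext_def by (auto simp: \<psi>_def)
    then obtain \<rho> where \<rho>: "(\<rho>, \<theta>) \<in> cond" "{\<rho>} \<tturnstile> \<psi>" "{\<rho>, imp \<chi> \<theta>} \<tturnstile> \<theta>"
      using p unfolding can.reg_def ext_def emb_def by fastforce
    have "{\<rho>} \<tturnstile> imp \<chi> \<theta>" using \<rho>(2) \<psi>(2) by (rule nd_trans)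
    then have "{\<rho>} \<tturnstile> \<theta>" using \<rho>(3) by (auto intro: cut simp: insert_commute)
    then show False using \<rho>(1) unfolding cond_def by auto
  qed
qed

text \<open>Injectivity comes from letting \<theta> vary. If \<psi> is not derivable from \<chi>,
  then (\<chi>, \<psi>) is a condition in \<open>emb \<chi>\<close>; it is not in
  \<open>emb \<psi>\<close>, because the negation of \<psi> relative to \<psi> itself is a
  theorem.\<close>

lemma emb_subset_iff:
  assumes "wff \<chi>" "wff \<psi>"
  shows "emb \<chi> \<subseteq> emb \<psi> \<longleftrightarrow> {\<chi>} \<tturnstile> \<psi>"
proof
  assume *: "emb \<chi> \<subseteq> emb \<psi>"
  show "{\<chi>} \<tturnstile> \<psi>"
  proof (rule ccontr)
    assume n: "\<not> {\<chi>} \<tturnstile> \<psi>"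
    have "{\<chi>, imp \<chi> \<psi>} \<tturnstile> \<psi>" using assms by (auto intro: hyp_mp)
    then have "(\<chi>, \<psi>) \<in> emb \<psi>" using n assms * unfolding emb_def cond_def by auto
    then have "insert (imp \<psi> \<psi>) {\<chi>} \<tturnstile> \<psi>" unfolding emb_def by (auto simp: insert_commute)
    moreover have "{\<chi>} \<tturnstile> imp \<psi> \<psi>" using assms by (intro impI hyp) auto
    ultimately show False using n cut by blast
  qed
next
  assume *: "{\<chi>} \<tturnstile> \<psi>"
  show "emb \<chi> \<subseteq> emb \<psi>"
  proof
    fix p assume p: "p \<in> emb \<chi>"
    obtain \<phi> \<theta> where [simp]: "p = (\<phi>, \<theta>)" by (cases p)
    have w: "wff \<theta>" using p unfolding emb_def cond_def by auto
    have "insert \<chi> {imp \<psi> \<theta>} \<tturnstile> \<theta>"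
      using cut_left[OF *, of "{imp \<psi> \<theta>}" \<theta>] assms w by (auto intro: hyp_mp)
    then have "{imp \<psi> \<theta>} \<tturnstile> imp \<chi> \<theta>" using assms by (intro impI) auto
    then have "{imp \<psi> \<theta>, \<phi>} \<tturnstile> \<theta>"
      using p cut_left[of "imp \<psi> \<theta>" "imp \<chi> \<theta>" "{\<phi>}"] unfolding emb_def
      by (auto simp: insert_commute)
    then show "p \<in> emb \<psi>" using p unfolding emb_def by (auto simp: insert_commute)
  qed
qed

lemma emb_fls: "emb fls = {}"
proof -
  have False if "(\<phi>, \<theta>) \<in> emb fls" for \<phi> \<theta>
  proof -
    have w: "wff \<theta>" "{\<phi>, imp fls \<theta>} \<tturnstile> \<theta>" "\<not> {\<phi>} \<tturnstile> \<theta>"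
      using that unfolding emb_def cond_def by auto
    then show False using cut[OF nd.ax[OF ax_fls[of \<theta>]]] by (metis insert_commute)
  qed
  then show ?thesis by auto
qed

lemma emb_top: "\<omega> \<in> L \<Longrightarrow> emb \<omega> = cond"
proof -
  assume t: "\<omega> \<in> L"
  have "{\<phi>, imp \<omega> \<theta>} \<tturnstile> \<theta>" if "wff \<theta>" for \<phi> \<theta>
    using t that L_wff[OF t] by (intro impE[OF nd.ax[OF t] hyp]) auto
  then show ?thesis unfolding emb_def cond_def by auto
qed

text \<open>\<open>S\<close> may be infinite, as the existential quantifier requires. The premise
  \<open>least\<close> carries a side formula \<phi>: the join has to be distributive, because
  conditions are strengthened by conjunction.\<close>

lemma emb_sup:
  assumes "wff \<sigma>" "\<And>\<alpha>. \<alpha> \<in> S \<Longrightarrow> wff \<alpha>" "\<And>\<alpha>. \<alpha> \<in> S \<Longrightarrow> {\<alpha>} \<tturnstile> \<sigma>"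
    and least: "\<And>\<phi> \<theta>. wff \<phi> \<Longrightarrow> wff \<theta> \<Longrightarrow> (\<And>\<alpha>. \<alpha> \<in> S \<Longrightarrow> {\<alpha>, \<phi>} \<tturnstile> \<theta>) \<Longrightarrow> {\<sigma>, \<phi>} \<tturnstile> \<theta>"
  shows "can.reg (\<Union>\<alpha>\<in>S. emb \<alpha>) = emb \<sigma>"
proof
  show "can.reg (\<Union>\<alpha>\<in>S. emb \<alpha>) \<subseteq> emb \<sigma>"
    using assms emb_subset_iff by (intro can.reg_least regular_emb) blast+
  show "emb \<sigma> \<subseteq> can.reg (\<Union>\<alpha>\<in>S. emb \<alpha>)"
  proof
    fix p assume p: "p \<in> emb \<sigma>"
    have "\<exists>r\<in>cond. ext r q \<and> r \<in> (\<Union>\<alpha>\<in>S. emb \<alpha>)" if q: "q \<in> cond" "ext q p" for q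
    proof -
      obtain \<phi> \<theta> where [simp]: "q = (\<phi>, \<theta>)" by (cases q)
      have q': "q \<in> emb \<sigma>"
        using q p regular_emb[OF assms(1)] unfolding can.regular_def can.downset_def by blast
      have w: "wff \<phi>" "wff \<theta>" "\<not> {\<phi>} \<tturnstile> \<theta>" using q unfolding cond_def by auto
      have "\<not> {\<sigma>, \<phi>} \<tturnstile> \<theta>"
      proof
        assume "{\<sigma>, \<phi>} \<tturnstile> \<theta>"
        then have "{\<phi>} \<tturnstile> imp \<sigma> \<theta>" using assms(1) by (rule impI)
        then show False using q' w cut[of "{\<phi>}" "imp \<sigma> \<theta>" \<theta>] unfolding emb_def
          by (auto simp: insert_commute)
      qed
      \<comment> \<open>This \<alpha> yields the extension: strengthening \<phi> by \<alpha> remains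
        a condition for \<theta>, and it lies in \<open>emb \<alpha>\<close>.\<close>
      then obtain \<alpha> where \<alpha>: "\<alpha> \<in> S" "\<not> {\<alpha>, \<phi>} \<tturnstile> \<theta>" using least w by blast
      have wa: "wff \<alpha>" using \<alpha> assms by blast
      have "(con \<alpha> \<phi>, \<theta>) \<in> cond" using \<alpha>(2) wa w unfolding cond_def by (simp add: nd_con_left)
      moreover have "{con \<alpha> \<phi>, imp \<alpha> \<theta>} \<tturnstile> \<theta>"
        using wa w by (simp add: nd_con_left) (auto intro: hyp_mp)
      moreover have "{con \<alpha> \<phi>} \<tturnstile> \<phi>" using wa w by (auto intro: hyp simp: nd_con_left)
      ultimately show ?thesis using \<alpha> unfolding ext_def emb_def
        by (intro bexI[of _ "(con \<alpha> \<phi>, \<theta>)"]) auto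
    qed
    then show "p \<in> can.reg (\<Union>\<alpha>\<in>S. emb \<alpha>)" using p unfolding can.reg_def emb_def by blast
  qed
qed

lemma emb_dis:
  assumes "wff \<phi>" "wff \<psi>"
  shows "emb (dis \<phi> \<psi>) = can.reg (emb \<phi> \<union> emb \<psi>)"
proof -
  have "can.reg (\<Union>\<alpha>\<in>{\<phi>, \<psi>}. emb \<alpha>) = emb (dis \<phi> \<psi>)"
  proof (rule emb_sup)
    fix \<rho> \<theta> assume *: "wff \<rho>" "\<And>\<alpha>. \<alpha> \<in> {\<phi>, \<psi>} \<Longrightarrow> {\<alpha>, \<rho>} \<tturnstile> \<theta>"
    show "{dis \<phi> \<psi>, \<rho>} \<tturnstile> \<theta>"
    proof (rule disE)
      show "{dis \<phi> \<psi>, \<rho>} \<tturnstile> dis \<phi> \<psi>" using assms by (auto intro: hyp)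
      show "{\<phi>, dis \<phi> \<psi>, \<rho>} \<tturnstile> \<theta>" by (rule nd_mono[OF *(2)[of \<phi>]]) auto
      show "{\<psi>, dis \<phi> \<psi>, \<rho>} \<tturnstile> \<theta>" by (rule nd_mono[OF *(2)[of \<psi>]]) auto
    qed
  qed (use assms in \<open>auto intro: disI1 disI2 nd_refl\<close>)
  then show ?thesis by auto
qed

lemma emb_con:
  assumes "wff \<phi>" "wff \<psi>"
  shows "emb (con \<phi> \<psi>) = emb \<phi> \<inter> emb \<psi>"
proof
  show "emb (con \<phi> \<psi>) \<subseteq> emb \<phi> \<inter> emb \<psi>"
    using assms emb_subset_iff by (auto simp: nd_con_left intro!: hyp)
  show "emb \<phi> \<inter> emb \<psi> \<subseteq> emb (con \<phi> \<psi>)"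
  proof
    fix p assume p: "p \<in> emb \<phi> \<inter> emb \<psi>"
    obtain \<rho> \<theta> where [simp]: "p = (\<rho>, \<theta>)" by (cases p)
    have w: "wff \<rho>" "wff \<theta>" and *: "{\<rho>, imp \<phi> \<theta>} \<tturnstile> \<theta>" "{\<rho>, imp \<psi> \<theta>} \<tturnstile> \<theta>"
      using p unfolding emb_def cond_def by auto
    let ?\<Gamma> = "{\<rho>, imp (con \<phi> \<psi>) \<theta>}"
    have "insert \<psi> (insert \<phi> ?\<Gamma>) \<tturnstile> \<theta>"
      using assms w by (intro impE[OF conI[OF hyp[of \<phi>] hyp[of \<psi>]] hyp]) auto
    then have "insert \<phi> ?\<Gamma> \<tturnstile> imp \<psi> \<theta>" using assms by (intro impI) auto
    then have "insert \<phi> ?\<Gamma> \<tturnstile> \<theta>" by (rule cut) (rule nd_mono[OF *(2)], auto)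
    then have "?\<Gamma> \<tturnstile> imp \<phi> \<theta>" using assms by (intro impI) auto
    then have "?\<Gamma> \<tturnstile> \<theta>" by (rule cut) (rule nd_mono[OF *(1)], auto)
    then show "p \<in> emb (con \<phi> \<psi>)" using p unfolding emb_def by auto
  qed
qed

text \<open>With the embedded formulas as generators, \<open>can.box U\<close> is the join of all
  embedded formulas below \<open>U\<close>.\<close>

sublocale can: interior_forcing cond ext "emb ` Collect wff"
proof
  show "can.regular U" if "U \<in> emb ` Collect wff" for U
    using that regular_emb by auto
  have t: "imp fls fls \<in> L" by (rule ax_fls) simp
  show "cond \<in> emb ` Collect wff"
    using emb_top[OF t] L_wff[OF t] by (intro image_eqI[of _ _ "imp fls fls"]) auto
  show "U \<inter> V \<in> emb ` Collect wff" if "U \<in> emb ` Collect wff" "V \<in> emb ` Collect wff" for U V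
    using that by (auto simp: emb_con[symmetric])
qed

lemma box_emb: "wff \<chi> \<Longrightarrow> can.box (emb \<chi>) = emb \<chi>"
  by (rule can.box_J) auto

text \<open>If \<mu> is the greatest formula below \<open>U\<close>, the join defining the box of
  \<open>U\<close> is attained at \<mu>.\<close>

lemma box_eq_embI:
  assumes "wff \<mu>" "can.regular U" "\<And>\<chi>. wff \<chi> \<Longrightarrow> emb \<chi> \<subseteq> U \<longleftrightarrow> {\<chi>} \<tturnstile> \<mu>"
  shows "can.box U = emb \<mu>"
proof
  show "can.box U \<subseteq> emb \<mu>" unfolding can.box_def
    using assms emb_subset_iff by (intro can.reg_least regular_emb) blast+
  show "emb \<mu> \<subseteq> can.box U"
    using assms nd_refl by (intro can.J_subset_box) auto
qed

text \<open>Residuation on both sides: a formula \<chi> lies below the Boolean implication iff its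
  conjunction with \<phi> derives \<psi>, hence iff it derives
  \<open>imp \<phi> \<psi>\<close>.\<close>

lemma emb_imp:
  assumes "wff \<phi>" "wff \<psi>"
  shows "emb (imp \<phi> \<psi>) = can.box (can.himp (emb \<phi>) (emb \<psi>))"
proof (rule box_eq_embI[symmetric])
  show "can.regular (can.himp (emb \<phi>) (emb \<psi>))"
    using assms by (intro can.regular_himp can.regular_downset regular_emb)
  fix \<chi> assume c: "wff \<chi>"
  have "emb \<chi> \<subseteq> can.himp (emb \<phi>) (emb \<psi>) \<longleftrightarrow> emb \<chi> \<inter> emb \<phi> \<subseteq> emb \<psi>"
    using assms c by (intro can.subset_himp_iff can.regular_downset regular_emb)
  also have "\<dots> \<longleftrightarrow> {con \<chi> \<phi>} \<tturnstile> \<psi>"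
    using assms c by (simp add: emb_con[symmetric] emb_subset_iff)
  also have "\<dots> \<longleftrightarrow> {\<chi>} \<tturnstile> imp \<phi> \<psi>"
    using assms c impI[of \<phi> "{\<chi>}" \<psi>] impD[of "{\<chi>}" \<phi> \<psi>]
    by (auto simp: nd_con_left insert_commute)
  finally show "emb \<chi> \<subseteq> can.himp (emb \<phi>) (emb \<psi>) \<longleftrightarrow> {\<chi>} \<tturnstile> imp \<phi> \<psi>" .
qed (use assms in auto)

text \<open>For the universal quantifier. In contrast to \<open>emb_sup\<close> no side formula
  occurs: it suffices that \<mu> is the greatest lower bound among formulas, since
  \<open>box\<close> looks only at formulas below the intersection.\<close>

lemma emb_inf:
  assumes "wff \<mu>" "S \<noteq> {}" "\<And>\<alpha>. \<alpha> \<in> S \<Longrightarrow> wff \<alpha>" "\<And>\<alpha>. \<alpha> \<in> S \<Longrightarrow> {\<mu>} \<tturnstile> \<alpha>"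
    and greatest: "\<And>\<chi>. wff \<chi> \<Longrightarrow> (\<And>\<alpha>. \<alpha> \<in> S \<Longrightarrow> {\<chi>} \<tturnstile> \<alpha>) \<Longrightarrow> {\<chi>} \<tturnstile> \<mu>"
  shows "can.box (\<Inter>\<alpha>\<in>S. emb \<alpha>) = emb \<mu>"
proof (rule box_eq_embI)
  show "can.regular (\<Inter>\<alpha>\<in>S. emb \<alpha>)" using assms by (intro can.regular_INT regular_emb)
  show "emb \<chi> \<subseteq> (\<Inter>\<alpha>\<in>S. emb \<alpha>) \<longleftrightarrow> {\<chi>} \<tturnstile> \<mu>" if c: "wff \<chi>" for \<chi>
  proof -
    have "emb \<chi> \<subseteq> (\<Inter>\<alpha>\<in>S. emb \<alpha>) \<longleftrightarrow> (\<forall>\<alpha>\<in>S. {\<chi>} \<tturnstile> \<alpha>)"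
      by (simp add: le_INF_iff emb_subset_iff assms(3) c)
    then show ?thesis using greatest[OF c] assms(4) nd_trans by blast
  qed
qed (use assms in auto)

lemma emb_eq_cond_iff:
  assumes "wff \<chi>"
  shows "emb \<chi> = cond \<longleftrightarrow> \<chi> \<in> L"
proof
  assume "emb \<chi> = cond"
  then have "emb (imp fls fls) \<subseteq> emb \<chi>" using emb_top[OF ax_fls[OF wff_fls]] by simp
  then have "imp (imp fls fls) \<chi> \<in> L" using assms by (simp add: emb_subset_iff imp_in_L_iff)
  then show "\<chi> \<in> L" using L_mp ax_fls[OF wff_fls] by blast
qed (rule emb_top)

end

section \<open>Algebraic semantics of the modal logics\<close>

lemma mfm_subst_fresh: "x \<notin> mfm_fv \<Phi> \<Longrightarrow> mfm_subst x t \<Phi> = \<Phi>"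
proof (induction \<Phi>)
  case (MAtom P ts)
  have "tm_subst x t s = s" if "s \<in> set ts" for s
    using MAtom that by (cases s) auto
  then show ?case by (simp add: map_idI)
qed auto

text \<open>A Boolean-valued model in which every predicate has two separate interpretations,
  selected by the Boolean argument of \<open>I\<close>. The domain is constant; its being nonempty
  keeps the intersections for quantifiers regular.\<close>

locale twist_model = interior_forcing X le J for X :: "'x set" and le J +
  fixes D :: "'d set" and cst :: "'c \<Rightarrow> 'd" and I :: "bool \<Rightarrow> 'p \<Rightarrow> 'd list \<Rightarrow> 'x set"
  assumes D_nonempty: "D \<noteq> {}"
    and cst_in_D: "cst c \<in> D"
    and regular_I: "regular (I b P ds)"
begin

primrec tm_val :: "(nat \<Rightarrow> 'd) \<Rightarrow> 'c tm \<Rightarrow> 'd" where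
  "tm_val e (Var x) = e x"
| "tm_val e (Const c) = cst c"

text \<open>The Boolean argument selects the value of verification (\<open>True\<close>) or of falsification.\<close>

primrec val :: "('p, 'c) mfm \<Rightarrow> bool \<Rightarrow> (nat \<Rightarrow> 'd) \<Rightarrow> 'x set" where
  "val (MAtom P ts) b e = I b P (map (tm_val e) ts)"
| "val \<bottom>\<^sub>M b e = (if b then {} else X)"
| "val (\<Phi> \<rightarrow>\<^sub>M \<Psi>) b e =
     (if b then himp (val \<Phi> True e) (val \<Psi> True e) else val \<Phi> True e \<inter> val \<Psi> False e)"
| "val (\<Phi> \<and>\<^sub>M \<Psi>) b e = (if b then val \<Phi> b e \<inter> val \<Psi> b e else reg (val \<Phi> b e \<union> val \<Psi> b e))"
| "val (\<Phi> \<or>\<^sub>M \<Psi>) b e = (if b then reg (val \<Phi> b e \<union> val \<Psi> b e) else val \<Phi> b e \<inter> val \<Psi> b e)"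
| "val (\<sim>\<^sub>M \<Phi>) b e = val \<Phi> (\<not> b) e"
| "val (\<box>\<Phi>) b e = (if b then box (val \<Phi> b e) else dia (val \<Phi> b e))"
| "val (\<diamond>\<Phi>) b e = (if b then dia (val \<Phi> b e) else box (val \<Phi> b e))"
| "val (MAll x \<Phi>) b e =
     (if b then \<Inter>d\<in>D. val \<Phi> b (e(x := d)) else reg (\<Union>d\<in>D. val \<Phi> b (e(x := d))))"
| "val (MEx x \<Phi>) b e =
     (if b then reg (\<Union>d\<in>D. val \<Phi> b (e(x := d))) else \<Inter>d\<in>D. val \<Phi> b (e(x := d)))"

lemma regular_val: "regular (val \<Phi> b e)"
  by (induction \<Phi> arbitrary: b e)
    (auto intro!: regular_I regular_empty regular_X regular_himp regular_downset regular_Int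
      regular_reg regular_box regular_dia regular_INT simp: D_nonempty)

lemma downset_val: "downset (val \<Phi> b e)"
  by (rule regular_downset[OF regular_val])

lemma val_subset_X: "val \<Phi> b e \<subseteq> X"
  by (rule regular_subset[OF regular_val])

lemma tm_val_cong: "(\<And>x. x \<in> tm_vars t \<Longrightarrow> e x = e' x) \<Longrightarrow> tm_val e t = tm_val e' t"
  by (cases t) auto

lemma tm_val_subst: "tm_val e (tm_subst x t s) = tm_val (e(x := tm_val e t)) s"
  by (cases s) auto

lemma tm_val_in_D: "range e \<subseteq> D \<Longrightarrow> tm_val e t \<in> D"
  by (cases t) (auto simp: cst_in_D)

lemma val_cong: "(\<And>x. x \<in> mfm_fv \<Phi> \<Longrightarrow> e x = e' x) \<Longrightarrow> val \<Phi> b e = val \<Phi> b e'"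
proof (induction \<Phi> arbitrary: b e e')
  case (MAtom P ts)
  then have "map (tm_val e) ts = map (tm_val e') ts" by (auto intro!: tm_val_cong)
  then show ?case by (simp del: map_eq_conv)
next
  case (MAll x \<Phi>)
  have "val \<Phi> c (e(x := d)) = val \<Phi> c (e'(x := d))" for c d
    by (rule MAll.IH) (use MAll.prems in auto)
  then show ?case by simp
next
  case (MEx x \<Phi>)
  have "val \<Phi> c (e(x := d)) = val \<Phi> c (e'(x := d))" for c d
    by (rule MEx.IH) (use MEx.prems in auto)
  then show ?case by simp
next
  case (MImp \<Phi> \<Psi>)
  have "val \<Phi> c e = val \<Phi> c e'" "val \<Psi> c e = val \<Psi> c e'" for c
    by (rule MImp.IH, rule MImp.prems, simp)+
  then show ?case by simp
next
  case (MAnd \<Phi> \<Psi>)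
  have "val \<Phi> c e = val \<Phi> c e'" "val \<Psi> c e = val \<Psi> c e'" for c
    by (rule MAnd.IH, rule MAnd.prems, simp)+
  then show ?case by simp
next
  case (MOr \<Phi> \<Psi>)
  have "val \<Phi> c e = val \<Phi> c e'" "val \<Psi> c e = val \<Psi> c e'" for c
    by (rule MOr.IH, rule MOr.prems, simp)+
  then show ?case by simp
next
  case (MNeg \<Phi>)
  have "val \<Phi> c e = val \<Phi> c e'" for c by (rule MNeg.IH, rule MNeg.prems, simp)
  then show ?case by simp
next
  case (MBox \<Phi>)
  have "val \<Phi> c e = val \<Phi> c e'" for c by (rule MBox.IH, rule MBox.prems, simp)
  then show ?case by simp
next
  case (MDia \<Phi>)
  have "val \<Phi> c e = val \<Phi> c e'" for c by (rule MDia.IH, rule MDia.prems, simp)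
  then show ?case by simp
qed simp

lemma val_subst:
  "mfm_free_for t x \<Phi> \<Longrightarrow> val (mfm_subst x t \<Phi>) b e = val \<Phi> b (e(x := tm_val e t))"
proof (induction \<Phi> arbitrary: b e)
  case (MAtom P ts)
  show ?case by (simp add: comp_def tm_val_subst del: fun_upd_apply)
next
  case (MAll y \<Phi>)
  show ?case
  proof (cases "x \<in> mfm_fv (MAll y \<Phi>)")
    \<comment> \<open>When \<open>x\<close> is not free in the quantified formula,
      \<open>mfm_free_for\<close> holds vacuously and says nothing about the variables of
      \<open>t\<close>. The substitution is idle then, also if \<open>y = x\<close>.\<close>
    case False
    then have "val (MAll y \<Phi>) b e = val (MAll y \<Phi>) b (e(x := tm_val e t))"
      by (intro val_cong) auto
    then show ?thesis using mfm_subst_fresh[OF False, of t] by (simp only:)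
  next
    case True
    then have "y \<noteq> x" "y \<notin> tm_vars t" "mfm_free_for t x \<Phi>" using MAll.prems by auto
    moreover have "tm_val (e(y := d)) t = tm_val e t" for d
      using \<open>y \<notin> tm_vars t\<close> by (auto intro: tm_val_cong)
    ultimately have "val (mfm_subst x t \<Phi>) c (e(y := d)) = val \<Phi> c (e(x := tm_val e t, y := d))"
      for c d using MAll.IH[of c "e(y := d)"] by (simp only: fun_upd_twist)
    then show ?thesis using \<open>y \<noteq> x\<close> by (simp del: fun_upd_apply)
  qed
next
  case (MEx y \<Phi>)
  show ?case
  proof (cases "x \<in> mfm_fv (MEx y \<Phi>)")
    case False
    then have "val (MEx y \<Phi>) b e = val (MEx y \<Phi>) b (e(x := tm_val e t))"
      by (intro val_cong) auto
    then show ?thesis using mfm_subst_fresh[OF False, of t] by (simp only:)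
  next
    case True
    then have "y \<noteq> x" "y \<notin> tm_vars t" "mfm_free_for t x \<Phi>" using MEx.prems by auto
    moreover have "tm_val (e(y := d)) t = tm_val e t" for d
      using \<open>y \<notin> tm_vars t\<close> by (auto intro: tm_val_cong)
    ultimately have "val (mfm_subst x t \<Phi>) c (e(y := d)) = val \<Phi> c (e(x := tm_val e t, y := d))"
      for c d using MEx.IH[of c "e(y := d)"] by (simp only: fun_upd_twist)
    then show ?thesis using \<open>y \<noteq> x\<close> by (simp del: fun_upd_apply)
  qed
qed simp_all

section \<open>Validity and soundness of the modal calculi\<close>

definition valid :: "('p, 'c) mfm \<Rightarrow> bool" where
  "valid \<Phi> \<longleftrightarrow> (\<forall>e. range e \<subseteq> D \<longrightarrow> val \<Phi> True e = X)"

lemma valid_imp_iff: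
  "valid (\<Phi> \<rightarrow>\<^sub>M \<Psi>) \<longleftrightarrow> (\<forall>e. range e \<subseteq> D \<longrightarrow> val \<Phi> True e \<subseteq> val \<Psi> True e)"
  unfolding valid_def by (simp add: himp_eq_X_iff downset_val)

lemma valid_and_iff: "valid (\<Phi> \<and>\<^sub>M \<Psi>) \<longleftrightarrow> valid \<Phi> \<and> valid \<Psi>"
  unfolding valid_def using val_subset_X by fastforce

lemma valid_iffI:
  "(\<And>e. range e \<subseteq> D \<Longrightarrow> val \<Phi> True e = val \<Psi> True e) \<Longrightarrow> valid (\<Phi> \<leftrightarrow>\<^sub>M \<Psi>)"
  unfolding valid_and_iff valid_imp_iff by blast

lemma range_upd: "range e \<subseteq> D \<Longrightarrow> d \<in> D \<Longrightarrow> range (e(x := d)) \<subseteq> D"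
  by auto

lemmas subset_himp = subset_himp_iff downset_val downset_himp downset_Int downset_reg

lemma QBK_axioms_valid: "\<Phi> \<in> QBK_axioms \<Longrightarrow> valid \<Phi>"
proof (induction rule: QBK_axioms.induct)
  case (imp_S \<Phi> \<Psi> \<Theta>)
  have "himp U (himp V W) \<inter> himp U V \<inter> U \<subseteq> W" for U V W
    using himp_mp by blast
  then show ?case unfolding valid_imp_iff by (simp add: subset_himp)
next
  case (or_elim \<Phi> \<Theta> \<Psi>)
  show ?case unfolding valid_imp_iff
  proof (intro allI impI)
    fix e
    let ?A = "val \<Phi> True e" and ?B = "val \<Psi> True e" and ?C = "val \<Theta> True e"
    let ?H = "himp ?A ?C \<inter> himp ?B ?C"
    \<comment> \<open>The goal is transposed by residuation: the join of \<open>?A\<close> and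
      \<open>?B\<close> is the least regular set above their union, so it suffices to place both
      inside the regular set \<open>himp ?H ?C\<close>.\<close>
    have "?A \<union> ?B \<subseteq> himp ?H ?C" using himp_mp by (auto simp: subset_himp)
    then have "reg (?A \<union> ?B) \<subseteq> himp ?H ?C"
      by (intro reg_least regular_himp regular_val downset_Int downset_himp)
    then show "val (\<Phi> \<rightarrow>\<^sub>M \<Theta>) True e \<subseteq> val ((\<Psi> \<rightarrow>\<^sub>M \<Theta>) \<rightarrow>\<^sub>M \<Phi> \<or>\<^sub>M \<Psi> \<rightarrow>\<^sub>M \<Theta>) True e"
      by (auto simp: subset_himp)
  qed
next
  case (excluded_middle \<Phi>)
  show ?case unfolding valid_def by (simp add: reg_Un_himp)
next
  case (box_and \<Phi> \<Psi>)
  show ?case unfolding valid_imp_iff using box_Int by simp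
next
  case (box_imp_refl \<Phi>)
  show ?case unfolding valid_def by (simp add: himp_self box_X)
next
  case (not_box \<Phi>)
  show ?case by (rule valid_iffI) (simp add: dia_def himp_empty_empty regular_val)
next
  case (not_dia \<Phi>)
  show ?case by (rule valid_iffI) (simp add: dia_def himp_empty_empty regular_box)
next
  case (box_strong_dual \<Phi>)
  show ?case by (subst valid_and_iff, intro conjI valid_iffI) simp_all
next
  case (dia_strong_dual \<Phi>)
  show ?case by (subst valid_and_iff, intro conjI valid_iffI) simp_all
next
  case (all_inst t x \<Phi>)
  then show ?case unfolding valid_imp_iff using tm_val_in_D by (auto simp: val_subst)
next
  case (ex_inst t x \<Phi>)
  have "val \<Phi> True (e(x := tm_val e t)) \<subseteq> reg (\<Union>d\<in>D. val \<Phi> True (e(x := d)))"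
    if "range e \<subseteq> D" for e
    using tm_val_in_D[OF that] reg_upper[OF downset_UN[of D "\<lambda>d. val \<Phi> True (e(x := d))"]]
      downset_val by blast
  then show ?case unfolding valid_imp_iff using ex_inst by (simp add: val_subst)
next
  case (or_intro1 \<Phi> \<Psi>)
  show ?case unfolding valid_imp_iff using reg_upper[OF downset_Un[OF downset_val downset_val]] by auto
next
  case (or_intro2 \<Phi> \<Psi>)
  show ?case unfolding valid_imp_iff using reg_upper[OF downset_Un[OF downset_val downset_val]] by auto
next
  case neg_bot
  show ?case unfolding valid_def by simp
qed (simp_all add: valid_and_iff valid_imp_iff subset_himp)

lemma QBK_ext_valid:
  assumes Ax: "\<And>\<Phi>. \<Phi> \<in> Ax \<Longrightarrow> valid \<Phi>"
  shows "\<Phi> \<in> QBK_ext \<sigma> Ax \<Longrightarrow> valid \<Phi>"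
proof (induction rule: QBK_ext.induct)
  case (ax \<Phi>)
  then show ?case using Ax QBK_axioms_valid by auto
next
  case (mp \<Phi> \<Psi>)
  have "val \<Psi> True e = X" if "range e \<subseteq> D" for e
    using mp(3,4) that val_subset_X[of \<Psi> True e] unfolding valid_imp_iff
    by (auto simp: valid_def)
  then show ?case unfolding valid_def by blast
next
  case (mono_box \<Phi> \<Psi>)
  then show ?case unfolding valid_imp_iff using box_mono by simp
next
  case (mono_dia \<Phi> \<Psi>)
  then show ?case unfolding valid_imp_iff using dia_mono by simp
next
  case (bernays_all \<Phi> \<Psi> x)
  have "val \<Phi> True e \<subseteq> val \<Psi> True (e(x := d))" if "range e \<subseteq> D" "d \<in> D" for e d
  proof -
    have "val \<Phi> True e = val \<Phi> True (e(x := d))" using bernays_all(2) by (intro val_cong) auto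
    then show ?thesis using bernays_all(3) range_upd[OF that] unfolding valid_imp_iff by blast
  qed
  then show ?case unfolding valid_imp_iff by auto
next
  case (bernays_ex \<Phi> \<Psi> x)
  have "val \<Phi> True (e(x := d)) \<subseteq> val \<Psi> True e" if "range e \<subseteq> D" "d \<in> D" for e d
  proof -
    have "val \<Psi> True e = val \<Psi> True (e(x := d))" using bernays_ex(2) by (intro val_cong) auto
    then show ?thesis using bernays_ex(3) range_upd[OF that] unfolding valid_imp_iff by blast
  qed
  then have "reg (\<Union>d\<in>D. val \<Phi> True (e(x := d))) \<subseteq> val \<Psi> True e" if "range e \<subseteq> D" for e
    using that by (intro reg_least regular_val UN_least)
  then show ?case unfolding valid_imp_iff by simp
qed

lemma S4_axioms_valid: "\<Phi> \<in> S4_axioms \<Longrightarrow> valid \<Phi>"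
  unfolding S4_axioms_def
  by (auto simp: valid_imp_iff dest: subsetD[OF box_subset[OF regular_val]]
      subsetD[OF box_subset_box_box])

text \<open>Disjointness spreads from atoms. Whenever one of the two values is a join, the other is
  the corresponding meet, and \<open>reg_disjoint\<close> applies.\<close>

lemma val_True_Int_False:
  assumes "\<And>P ds. I True P ds \<inter> I False P ds = {}"
  shows "val \<Phi> True e \<inter> val \<Phi> False e = {}"
proof (induction \<Phi> arbitrary: e)
  case (MAtom P ts)
  then show ?case using assms by simp
next
  case (MImp \<Phi> \<Psi>)
  then show ?case using himp_mp[of "val \<Phi> True e" "val \<Psi> True e"] by (simp, blast)
next
  case (MAnd \<Phi> \<Psi>)
  have "reg (val \<Phi> False e \<union> val \<Psi> False e) \<inter> (val \<Phi> True e \<inter> val \<Psi> True e) = {}"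
    by (rule reg_disjoint) (use MAnd.IH in \<open>blast intro: downset_Int downset_val\<close>)+
  then show ?case by (simp add: Int_commute)
next
  case (MOr \<Phi> \<Psi>)
  have "reg (val \<Phi> True e \<union> val \<Psi> True e) \<inter> (val \<Phi> False e \<inter> val \<Psi> False e) = {}"
    by (rule reg_disjoint) (use MOr.IH in \<open>blast intro: downset_Int downset_val\<close>)+
  then show ?case by simp
next
  case (MNeg \<Phi>)
  then show ?case by (simp add: Int_commute)
next
  case (MBox \<Phi>)
  then show ?case by (simp add: box_Int_dia_empty regular_val)
next
  case (MDia \<Phi>)
  then show ?case using box_Int_dia_empty[OF regular_val regular_val, of \<Phi> False e \<Phi> True e]
    by (simp add: Int_commute)
next
  case (MAll x \<Phi>)
  have "reg (\<Union>d\<in>D. val \<Phi> False (e(x := d))) \<inter> (\<Inter>d\<in>D. val \<Phi> True (e(x := d))) = {}"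
    by (rule reg_disjoint) (use MAll.IH downset_val[of "MAll x \<Phi>" True] in auto)
  then show ?case by (simp add: Int_commute)
next
  case (MEx x \<Phi>)
  have "reg (\<Union>d\<in>D. val \<Phi> True (e(x := d))) \<inter> (\<Inter>d\<in>D. val \<Phi> False (e(x := d))) = {}"
    by (rule reg_disjoint) (use MEx.IH downset_val[of "MEx x \<Phi>" False] in auto)
  then show ?case by simp
qed auto

end

section \<open>From Nelson's logics to modal logic\<close>

lemma QBK_ext_wf: "\<Phi> \<in> QBK_ext \<sigma> Ax \<Longrightarrow> mfm_wf \<sigma> \<Phi>"
  by (induction rule: QBK_ext.induct) auto

interpretation M: int_calculus "mfm_wf \<sigma>" MImp MAnd MOr MBot "QBK_ext \<sigma> Ax"
  for \<sigma> :: "('p, 'c) signature" and Ax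
proof
  show "\<psi> \<in> QBK_ext \<sigma> Ax" if "\<phi> \<in> QBK_ext \<sigma> Ax" "\<phi> \<rightarrow>\<^sub>M \<psi> \<in> QBK_ext \<sigma> Ax" for \<phi> \<psi>
    using that by (rule QBK_ext.mp)
qed (auto intro: QBK_ext_wf QBK_ext.ax QBK_axioms.intros)

lemma mfm_subst_Var_self: "mfm_subst x (Var x) \<Phi> = \<Phi>"
proof (induction \<Phi>)
  case (MAtom P ts)
  have "tm_subst x (Var x) s = s" for s :: "'b tm" by (cases s) auto
  then show ?case by (simp add: map_idI)
qed auto

lemma mfm_free_for_Var_self: "mfm_free_for (Var x) x \<Phi>"
  by (induction \<Phi>) auto

text \<open>Treats \<open>QBS4\<close> and \<open>QB3S4\<close> at once.\<close>

locale s4_extension =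
  fixes \<sigma> :: "('p, 'c) signature" and Ax :: "('p, 'c) mfm set"
  assumes S4_axioms_subset: "S4_axioms \<subseteq> Ax"
begin

abbreviation nd :: "('p, 'c) mfm set \<Rightarrow> ('p, 'c) mfm \<Rightarrow> bool" (infix "\<tturnstile>" 50) where
  "\<Gamma> \<tturnstile> \<Phi> \<equiv> M.nd \<sigma> Ax \<Gamma> \<Phi>"

text \<open>Necessitation is not a primitive rule; it follows from monotonicity of the box and the
  axiom \<open>box_imp_refl\<close>.\<close>

lemma nec:
  assumes "\<Phi> \<in> QBK_ext \<sigma> Ax"
  shows "\<box>\<Phi> \<in> QBK_ext \<sigma> Ax"
proof -
  let ?T = "\<bottom>\<^sub>M \<rightarrow>\<^sub>M \<bottom>\<^sub>M"
  have "?T \<rightarrow>\<^sub>M \<Phi> \<in> QBK_ext \<sigma> Ax"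
    using QBK_ext.mp[OF assms] M.ax_K[of \<sigma> \<Phi> ?T] QBK_ext_wf[OF assms] by auto
  moreover have "\<box>?T \<in> QBK_ext \<sigma> Ax" by (rule QBK_ext.ax) (auto intro: QBK_axioms.intros)
  ultimately show ?thesis using QBK_ext.mono_box QBK_ext.mp by blast
qed

lemma nd_rule: "\<Phi> \<rightarrow>\<^sub>M \<Psi> \<in> QBK_ext \<sigma> Ax \<Longrightarrow> \<Gamma> \<tturnstile> \<Phi> \<Longrightarrow> \<Gamma> \<tturnstile> \<Psi>"
  using M.nd.intros by blast

lemma box_K:
  assumes "\<Gamma> \<tturnstile> \<box>(\<Phi> \<rightarrow>\<^sub>M \<Psi>)" "\<Gamma> \<tturnstile> \<box>\<Phi>"
  shows "\<Gamma> \<tturnstile> \<box>\<Psi>"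
proof -
  have w: "mfm_wf \<sigma> \<Phi>" "mfm_wf \<sigma> \<Psi>" using M.nd_wff[OF assms(1)] by auto
  have "{(\<Phi> \<rightarrow>\<^sub>M \<Psi>) \<and>\<^sub>M \<Phi>} \<tturnstile> \<Psi>"
    using w by (simp add: M.nd_con_left) (auto intro: M.hyp_mp)
  then have "((\<Phi> \<rightarrow>\<^sub>M \<Psi>) \<and>\<^sub>M \<Phi>) \<rightarrow>\<^sub>M \<Psi> \<in> QBK_ext \<sigma> Ax" using w by (simp add: M.imp_in_L_iff)
  then have "\<box>((\<Phi> \<rightarrow>\<^sub>M \<Psi>) \<and>\<^sub>M \<Phi>) \<rightarrow>\<^sub>M \<box>\<Psi> \<in> QBK_ext \<sigma> Ax" by (rule QBK_ext.mono_box)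
  moreover have "(\<box>(\<Phi> \<rightarrow>\<^sub>M \<Psi>) \<and>\<^sub>M \<box>\<Phi>) \<rightarrow>\<^sub>M \<box>((\<Phi> \<rightarrow>\<^sub>M \<Psi>) \<and>\<^sub>M \<Phi>) \<in> QBK_ext \<sigma> Ax"
    using w by (intro QBK_ext.ax) (auto intro: QBK_axioms.intros)
  ultimately show ?thesis using M.conI[OF assms] nd_rule by blast
qed

lemma box_T: "\<Gamma> \<tturnstile> \<box>\<Phi> \<Longrightarrow> \<Gamma> \<tturnstile> \<Phi>"
  using S4_axioms_subset M.nd_wff[of _ _ _ "\<box>\<Phi>"]
  by (intro nd_rule[of "\<box>\<Phi>" \<Phi>] QBK_ext.ax) (auto simp: S4_axioms_def)

lemma box_4: "\<Gamma> \<tturnstile> \<box>\<Phi> \<Longrightarrow> \<Gamma> \<tturnstile> \<box>\<box>\<Phi>"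
  using S4_axioms_subset M.nd_wff[of _ _ _ "\<box>\<Phi>"]
  by (intro nd_rule[of "\<box>\<Phi>" "\<box>\<box>\<Phi>"] QBK_ext.ax) (auto simp: S4_axioms_def)

text \<open>Syntactic counterpart of upward preservation in Kripke models. The guard makes formulas
  outside the signature persistent trivially, so that \<open>persistent_tr\<close> is
  unconditional.\<close>

definition persistent :: "('p, 'c) mfm \<Rightarrow> bool" where
  "persistent \<Phi> \<longleftrightarrow> (mfm_wf \<sigma> \<Phi> \<longrightarrow> {\<Phi>} \<tturnstile> \<box>\<Phi>)"

lemma persistentD:
  assumes "persistent \<Phi>" "\<Gamma> \<tturnstile> \<Phi>"
  shows "\<Gamma> \<tturnstile> \<box>\<Phi>"
  using assms M.nd_wff[OF assms(2)] by (intro nd_rule[of \<Phi> "\<box>\<Phi>"]) (auto simp: M.imp_in_L_iff persistent_def)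

text \<open>Box introduction of natural deduction for S4, by induction on the derivation: theorems
  are necessitated, persistent hypotheses imply their boxes, and modus ponens is carried along by
  K.\<close>

lemma boxI:
  assumes "\<Gamma> \<tturnstile> \<Phi>" "\<And>\<Psi>. \<Psi> \<in> \<Gamma> \<Longrightarrow> persistent \<Psi>"
  shows "\<Gamma> \<tturnstile> \<box>\<Phi>"
  using assms(1)
proof (induction rule: M.nd.induct)
  case (ax \<Phi>)
  then show ?case using nec M.nd.ax by blast
next
  case (hyp \<Phi>)
  then show ?case using persistentD assms(2) M.nd.hyp by blast
next
  case (impE \<Phi> \<Psi>)
  then show ?case using box_K by blast
qed

lemma strict_impI:
  "insert \<Phi> \<Gamma> \<tturnstile> \<Psi> \<Longrightarrow> mfm_wf \<sigma> \<Phi> \<Longrightarrow> (\<And>\<Psi>. \<Psi> \<in> \<Gamma> \<Longrightarrow> persistent \<Psi>) \<Longrightarrow> \<Gamma> \<tturnstile> \<box>(\<Phi> \<rightarrow>\<^sub>M \<Psi>)"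
  by (intro boxI M.impI)

lemma strict_impE: "\<Gamma> \<tturnstile> \<box>(\<Phi> \<rightarrow>\<^sub>M \<Psi>) \<Longrightarrow> \<Gamma> \<tturnstile> \<Phi> \<Longrightarrow> \<Gamma> \<tturnstile> \<Psi>"
  using box_T M.impE by blast

lemma persistent_box: "persistent (\<box>\<Phi>)"
  unfolding persistent_def by (auto intro!: box_4 M.hyp)

lemma nd_iff:
  assumes "\<Phi> \<leftrightarrow>\<^sub>M \<Psi> \<in> QBK_ext \<sigma> Ax"
  shows "\<Gamma> \<tturnstile> \<Phi> \<longleftrightarrow> \<Gamma> \<tturnstile> \<Psi>"
  using M.conE1[OF M.nd.ax[OF assms]] M.conE2[OF M.nd.ax[OF assms]] M.impE by blast

text \<open>Uses the strongly negated half of the duality axiom for the diamond, followed by removal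
  of a double strong negation.\<close>

lemma neg_dia_iff:
  assumes "mfm_wf \<sigma> \<Phi>"
  shows "\<Gamma> \<tturnstile> \<sim>\<^sub>M \<diamond>\<Phi> \<longleftrightarrow> \<Gamma> \<tturnstile> \<box>(\<sim>\<^sub>M \<Phi>)"
proof -
  let ?B = "\<box>(\<sim>\<^sub>M \<Phi>)"
  have "\<diamond>\<Phi> \<Leftrightarrow>\<^sub>M (\<sim>\<^sub>M ?B) \<in> QBK_ext \<sigma> Ax"
    using assms by (intro QBK_ext.ax) (auto intro: QBK_axioms.intros)
  then have "(\<sim>\<^sub>M \<diamond>\<Phi>) \<leftrightarrow>\<^sub>M (\<sim>\<^sub>M \<sim>\<^sub>M ?B) \<in> QBK_ext \<sigma> Ax"
    using M.conE2[of \<sigma> Ax "{}"] unfolding M.nd_empty_iff by blast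
  moreover have "(\<sim>\<^sub>M \<sim>\<^sub>M ?B) \<leftrightarrow>\<^sub>M ?B \<in> QBK_ext \<sigma> Ax"
    using assms by (intro QBK_ext.ax) (auto intro: QBK_axioms.intros)
  ultimately show ?thesis using nd_iff by blast
qed

end

text \<open>\<open>tr \<Phi> True\<close> and \<open>tr \<Phi> False\<close> are \<open>\<tau>\<close> of the negative normal forms of \<open>\<Phi>\<close> and of \<open>\<sim>\<Phi>\<close>.\<close>

primrec tr :: "('p, 'c) nfm \<Rightarrow> bool \<Rightarrow> ('p, 'c) mfm" where
  "tr (NAtom P ts) b = (if b then \<box>(MAtom P ts) else \<sim>\<^sub>M \<diamond>(MAtom P ts))"
| "tr \<bottom>\<^sub>N b = (if b then \<bottom>\<^sub>M else \<sim>\<^sub>M \<bottom>\<^sub>M)"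
| "tr (\<Phi> \<rightarrow>\<^sub>N \<Psi>) b = (if b then \<box>(tr \<Phi> True \<rightarrow>\<^sub>M tr \<Psi> True) else tr \<Phi> True \<and>\<^sub>M tr \<Psi> False)"
| "tr (\<Phi> \<and>\<^sub>N \<Psi>) b = (if b then tr \<Phi> b \<and>\<^sub>M tr \<Psi> b else tr \<Phi> b \<or>\<^sub>M tr \<Psi> b)"
| "tr (\<Phi> \<or>\<^sub>N \<Psi>) b = (if b then tr \<Phi> b \<or>\<^sub>M tr \<Psi> b else tr \<Phi> b \<and>\<^sub>M tr \<Psi> b)"
| "tr (\<sim>\<^sub>N \<Phi>) b = tr \<Phi> (\<not> b)"
| "tr (NAll x \<Phi>) b = (if b then \<box>(MAll x (tr \<Phi> b)) else MEx x (tr \<Phi> b))"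
| "tr (NEx x \<Phi>) b = (if b then MEx x (tr \<Phi> b) else \<box>(MAll x (tr \<Phi> b)))"

lemma tr_nnf: "nnf \<Phi> \<Longrightarrow> tr \<Phi> True = \<tau> \<Phi>"
  by (induction \<Phi> rule: nnf.induct) auto

lemma wf_tr [simp]: "mfm_wf \<sigma> (tr \<Phi> b) \<longleftrightarrow> nfm_wf \<sigma> \<Phi>"
  by (induction \<Phi> arbitrary: b) auto

lemma fv_tr [simp]: "mfm_fv (tr \<Phi> b) = nfm_fv \<Phi>"
  by (induction \<Phi> arbitrary: b) auto

lemma tr_subst: "tr (nfm_subst x t \<Phi>) b = mfm_subst x t (tr \<Phi> b)"
  by (induction \<Phi> arbitrary: b) auto

lemma free_for_tr [simp]: "mfm_free_for t x (tr \<Phi> b) \<longleftrightarrow> nfm_free_for t x \<Phi>"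
  by (induction \<Phi> arbitrary: b) auto

context s4_extension
begin

text \<open>Induction on the formula: boxed clauses are persistent by axiom 4, while conjunction,
  disjunction and the existential quantifier inherit persistence.\<close>

lemma persistent_tr: "persistent (tr \<Phi> b)"
proof -
  have ex: "persistent (MEx x \<Psi>)" if p: "persistent \<Psi>" for x and \<Psi> :: "('p, 'c) mfm"
    unfolding persistent_def
  proof
    assume w: "mfm_wf \<sigma> (MEx x \<Psi>)"
    have "\<Psi> \<rightarrow>\<^sub>M MEx x \<Psi> \<in> QBK_ext \<sigma> Ax"
      using w QBK_axioms.ex_inst[OF mfm_free_for_Var_self, of x \<Psi>]
      by (intro QBK_ext.ax) (auto simp: mfm_subst_Var_self)
    then have "{\<Psi>} \<tturnstile> \<box>(MEx x \<Psi>)"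
      using p w by (auto simp: M.imp_in_L_iff intro: boxI)
    then have "MEx x \<Psi> \<rightarrow>\<^sub>M \<box>(MEx x \<Psi>) \<in> QBK_ext \<sigma> Ax"
      using w by (intro QBK_ext.bernays_ex) (auto simp: M.imp_in_L_iff)
    then show "{MEx x \<Psi>} \<tturnstile> \<box>(MEx x \<Psi>)" by (simp add: M.imp_in_L_iff)
  qed
  have and_: "persistent (\<Psi> \<and>\<^sub>M \<Theta>)" if p: "persistent \<Psi>" "persistent \<Theta>" for \<Psi> \<Theta>
    unfolding persistent_def
  proof
    assume "mfm_wf \<sigma> (\<Psi> \<and>\<^sub>M \<Theta>)"
    then have w: "mfm_wf \<sigma> \<Psi>" "mfm_wf \<sigma> \<Theta>" by auto
    have "{\<Psi>, \<Theta>} \<tturnstile> \<box>(\<Psi> \<and>\<^sub>M \<Theta>)"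
      using w p by (intro boxI M.conI M.hyp) auto
    then show "{\<Psi> \<and>\<^sub>M \<Theta>} \<tturnstile> \<box>(\<Psi> \<and>\<^sub>M \<Theta>)" using w by (simp add: M.nd_con_left)
  qed
  have or_: "persistent (\<Psi> \<or>\<^sub>M \<Theta>)" if p: "persistent \<Psi>" "persistent \<Theta>" for \<Psi> \<Theta>
    unfolding persistent_def
  proof
    assume "mfm_wf \<sigma> (\<Psi> \<or>\<^sub>M \<Theta>)"
    then have w: "mfm_wf \<sigma> \<Psi>" "mfm_wf \<sigma> \<Theta>" by auto
    have *: "{\<Psi>} \<tturnstile> \<box>(\<Psi> \<or>\<^sub>M \<Theta>)" "{\<Theta>} \<tturnstile> \<box>(\<Psi> \<or>\<^sub>M \<Theta>)"
      using w p by (auto intro!: boxI intro: M.disI1 M.disI2 M.hyp)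
    have "{\<Psi>, \<Psi> \<or>\<^sub>M \<Theta>} \<tturnstile> \<box>(\<Psi> \<or>\<^sub>M \<Theta>)" "{\<Theta>, \<Psi> \<or>\<^sub>M \<Theta>} \<tturnstile> \<box>(\<Psi> \<or>\<^sub>M \<Theta>)"
      by (rule *[THEN M.nd_mono], simp)+
    moreover have "{\<Psi> \<or>\<^sub>M \<Theta>} \<tturnstile> \<Psi> \<or>\<^sub>M \<Theta>" using w by (auto intro: M.hyp)
    ultimately show "{\<Psi> \<or>\<^sub>M \<Theta>} \<tturnstile> \<box>(\<Psi> \<or>\<^sub>M \<Theta>)" using M.disE by blast
  qed
  have "persistent \<bottom>\<^sub>M"
    unfolding persistent_def by (auto intro: M.flsE[OF M.hyp])
  moreover have "persistent (\<sim>\<^sub>M \<bottom>\<^sub>M)"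
  proof -
    have "\<sim>\<^sub>M \<bottom>\<^sub>M \<in> QBK_ext \<sigma> Ax" by (intro QBK_ext.ax) (auto intro: QBK_axioms.intros)
    then show ?thesis using nec M.nd.ax unfolding persistent_def by blast
  qed
  moreover have "persistent (\<sim>\<^sub>M \<diamond>(MAtom P ts))" for P and ts :: "'c tm list"
    unfolding persistent_def
  proof
    let ?A = "MAtom P ts"
    assume "mfm_wf \<sigma> (\<sim>\<^sub>M \<diamond>?A)"
    then have w: "mfm_wf \<sigma> ?A" by simp
    have "{\<sim>\<^sub>M \<diamond>?A} \<tturnstile> \<box>(\<sim>\<^sub>M ?A)"
      using w neg_dia_iff[OF w, of "{\<sim>\<^sub>M \<diamond>?A}"] by (auto intro: M.hyp)
    then have "{\<sim>\<^sub>M \<diamond>?A} \<tturnstile> \<box>\<box>(\<sim>\<^sub>M ?A)" by (rule box_4)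
    \<comment> \<open>The inner box is turned back into a strongly negated diamond under the outer
      one.\<close>
    moreover have "\<box>\<box>(\<sim>\<^sub>M ?A) \<rightarrow>\<^sub>M \<box>(\<sim>\<^sub>M \<diamond>?A) \<in> QBK_ext \<sigma> Ax"
      using w neg_dia_iff[OF w, of "{\<box>(\<sim>\<^sub>M ?A)}"]
      by (intro QBK_ext.mono_box) (auto simp: M.imp_in_L_iff intro: M.hyp)
    ultimately show "{\<sim>\<^sub>M \<diamond>?A} \<tturnstile> \<box>(\<sim>\<^sub>M \<diamond>?A)" using nd_rule by blast
  qed
  ultimately show ?thesis
    by (induction \<Phi> arbitrary: b) (auto intro: persistent_box and_ or_ ex)
qed

lemma all_instE: "\<Gamma> \<tturnstile> MAll x \<Phi> \<Longrightarrow> mfm_free_for t x \<Phi> \<Longrightarrow> mfm_wf \<sigma> (mfm_subst x t \<Phi>) \<Longrightarrow>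
  \<Gamma> \<tturnstile> mfm_subst x t \<Phi>"
  using M.nd_wff[of _ _ _ "MAll x \<Phi>"]
  by (intro nd_rule[of "MAll x \<Phi>" "mfm_subst x t \<Phi>"] QBK_ext.ax) (auto intro: QBK_axioms.intros)

lemma ex_instI: "\<Gamma> \<tturnstile> mfm_subst x t \<Phi> \<Longrightarrow> mfm_free_for t x \<Phi> \<Longrightarrow> mfm_wf \<sigma> \<Phi> \<Longrightarrow> \<Gamma> \<tturnstile> MEx x \<Phi>"
  using M.nd_wff[of _ _ _ "mfm_subst x t \<Phi>"]
  by (intro nd_rule[of "mfm_subst x t \<Phi>" "MEx x \<Phi>"] QBK_ext.ax) (auto intro: QBK_axioms.intros)

lemma strict_imp_in_QBK_ext:
  assumes "{\<Phi>} \<tturnstile> \<Psi>" "mfm_wf \<sigma> \<Phi>"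
  shows "\<box>(\<Phi> \<rightarrow>\<^sub>M \<Psi>) \<in> QBK_ext \<sigma> Ax"
  using assms by (intro nec) (simp add: M.imp_in_L_iff)

lemma strict_imp_in_QBK_extD:
  assumes "\<box>(\<Phi> \<rightarrow>\<^sub>M \<Psi>) \<in> QBK_ext \<sigma> Ax"
  shows "\<Phi> \<rightarrow>\<^sub>M \<Psi> \<in> QBK_ext \<sigma> Ax"
  using box_T[of "{}"] assms unfolding M.nd_empty_iff by blast

lemma strict_iff_refl: "mfm_wf \<sigma> \<Phi> \<Longrightarrow> \<box>(\<Phi> \<rightarrow>\<^sub>M \<Phi>) \<and>\<^sub>M \<box>(\<Phi> \<rightarrow>\<^sub>M \<Phi>) \<in> QBK_ext \<sigma> Ax"
  unfolding M.nd_empty_iff[symmetric]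
  by (intro M.conI M.nd.ax strict_imp_in_QBK_ext M.nd.hyp) auto

lemma tr_axiom:
  "\<Phi> \<in> QN4bot_axioms \<Longrightarrow> nfm_wf \<sigma> \<Phi> \<Longrightarrow> tr \<Phi> True \<in> QBK_ext \<sigma> Ax"
proof (induction rule: QN4bot_axioms.induct)
  case (imp_K \<Phi> \<Psi>)
  then show ?case
    by (auto intro!: strict_imp_in_QBK_ext strict_impI persistent_tr intro: M.hyp)
next
  case (imp_S \<Phi> \<Psi> \<Theta>)
  let ?A = "tr \<Phi> True" and ?B = "tr \<Psi> True" and ?C = "tr \<Theta> True"
  let ?\<Gamma> = "{?A, \<box>(?A \<rightarrow>\<^sub>M ?B), \<box>(?A \<rightarrow>\<^sub>M \<box>(?B \<rightarrow>\<^sub>M ?C))}"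
  have "?\<Gamma> \<tturnstile> ?A" "?\<Gamma> \<tturnstile> \<box>(?A \<rightarrow>\<^sub>M ?B)" "?\<Gamma> \<tturnstile> \<box>(?A \<rightarrow>\<^sub>M \<box>(?B \<rightarrow>\<^sub>M ?C))"
    using imp_S by (auto intro: M.hyp)
  then have "?\<Gamma> \<tturnstile> ?C" using strict_impE by blast
  then show ?case using imp_S
    by (auto intro!: strict_imp_in_QBK_ext strict_impI persistent_box)
next
  case (and_elim1 \<Phi> \<Psi>)
  then show ?case by (auto intro!: strict_imp_in_QBK_ext intro: M.conE1[OF M.hyp])
next
  case (and_elim2 \<Phi> \<Psi>)
  then show ?case by (auto intro!: strict_imp_in_QBK_ext intro: M.conE2[OF M.hyp])
next
  case (and_intro \<Phi> \<Psi>)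
  then show ?case
    by (auto intro!: strict_imp_in_QBK_ext strict_impI persistent_tr M.conI intro: M.hyp)
next
  case (or_intro1 \<Phi> \<Psi>)
  then show ?case by (auto intro!: strict_imp_in_QBK_ext M.disI1 intro: M.hyp)
next
  case (or_intro2 \<Psi> \<Phi>)
  then show ?case by (auto intro!: strict_imp_in_QBK_ext M.disI2 intro: M.hyp)
next
  case (or_elim \<Phi> \<Theta> \<Psi>)
  let ?A = "tr \<Phi> True" and ?B = "tr \<Psi> True" and ?C = "tr \<Theta> True"
  let ?\<Gamma> = "{?A \<or>\<^sub>M ?B, \<box>(?B \<rightarrow>\<^sub>M ?C), \<box>(?A \<rightarrow>\<^sub>M ?C)}"
  have "?\<Gamma> \<tturnstile> ?A \<or>\<^sub>M ?B" using or_elim by (auto intro: M.hyp)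
  moreover have "insert ?A ?\<Gamma> \<tturnstile> ?C" "insert ?B ?\<Gamma> \<tturnstile> ?C"
    by (rule strict_impE[of _ ?A], use or_elim in \<open>auto intro: M.hyp\<close>)
      (rule strict_impE[of _ ?B], use or_elim in \<open>auto intro: M.hyp\<close>)
  ultimately have "?\<Gamma> \<tturnstile> ?C" by (rule M.disE)
  then show ?case using or_elim
    by (auto intro!: strict_imp_in_QBK_ext strict_impI persistent_box)
next
  case (ex_falso \<Phi>)
  then show ?case by (auto intro!: strict_imp_in_QBK_ext intro: M.flsE[OF M.hyp])
next
  case neg_bot
  then show ?case by (auto intro!: QBK_ext.ax intro: QBK_axioms.intros)
next
  case (all_inst t x \<Phi>)
  let ?A = "tr \<Phi> True"
  have "{\<box>(MAll x ?A)} \<tturnstile> MAll x ?A" using all_inst by (auto intro: box_T[OF M.hyp])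
  then have "{\<box>(MAll x ?A)} \<tturnstile> mfm_subst x t ?A"
    using all_inst by (intro all_instE) (auto simp: tr_subst[symmetric])
  then show ?case using all_inst by (auto intro!: strict_imp_in_QBK_ext simp: tr_subst)
next
  case (ex_inst t x \<Phi>)
  then have "mfm_wf \<sigma> (mfm_subst x t (tr \<Phi> True))" by (auto simp: tr_subst[symmetric])
  then show ?case using ex_inst
    by (auto intro!: strict_imp_in_QBK_ext intro: ex_instI[OF M.hyp, of x t] simp: tr_subst)
\<comment> \<open>What remains are the equivalences for strong negation. Since \<open>tr\<close>
  pushes strong negation inwards, both sides have the same translation.\<close>
qed (auto intro!: strict_iff_refl)

lemma tr_QN4bot_ext:
  assumes tr_Ax: "\<And>\<Phi>. \<Phi> \<in> AxN \<Longrightarrow> nfm_wf \<sigma> \<Phi> \<Longrightarrow> tr \<Phi> True \<in> QBK_ext \<sigma> Ax"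
  shows "\<Phi> \<in> QN4bot_ext \<sigma> AxN \<Longrightarrow> tr \<Phi> True \<in> QBK_ext \<sigma> Ax"
proof (induction rule: QN4bot_ext.induct)
  case (ax \<Phi>)
  then show ?case using tr_axiom tr_Ax by blast
next
  case (mp \<Phi> \<Psi>)
  then show ?case using strict_imp_in_QBK_extD QBK_ext.mp by fastforce
next
  case (bernays_all \<Phi> \<Psi> x)
  have "tr \<Phi> True \<rightarrow>\<^sub>M MAll x (tr \<Psi> True) \<in> QBK_ext \<sigma> Ax"
    using bernays_all by (intro QBK_ext.bernays_all strict_imp_in_QBK_extD) auto
  \<comment> \<open>The extra box that the translation puts before a universal quantifier comes from
    persistence of the antecedent.\<close>
  then have "{tr \<Phi> True} \<tturnstile> \<box>(MAll x (tr \<Psi> True))" "nfm_wf \<sigma> \<Phi>"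
    by (auto simp: M.imp_in_L_iff intro!: boxI persistent_tr)
  then show ?case by (auto intro!: strict_imp_in_QBK_ext)
next
  case (bernays_ex \<Phi> \<Psi> x)
  have "MEx x (tr \<Phi> True) \<rightarrow>\<^sub>M tr \<Psi> True \<in> QBK_ext \<sigma> Ax"
    using bernays_ex by (intro QBK_ext.bernays_ex strict_imp_in_QBK_extD) auto
  then show ?case by (auto intro: nec)
qed

section \<open>Explosion under the translation\<close>

lemma ex_all_clash:
  assumes "{\<Phi>, \<Psi>} \<tturnstile> \<bottom>\<^sub>M" "mfm_wf \<sigma> \<Phi>" "mfm_wf \<sigma> \<Psi>"
  shows "{MEx x \<Phi>, \<box>(MAll x \<Psi>)} \<tturnstile> \<bottom>\<^sub>M"
proof -
  let ?\<Gamma> = "{\<Phi>, \<box>(MAll x \<Psi>)}"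
  have "?\<Gamma> \<tturnstile> MAll x \<Psi>" using assms by (auto intro: box_T[OF M.hyp])
  then have "?\<Gamma> \<tturnstile> \<Psi>"
    using all_instE[OF _ mfm_free_for_Var_self, of ?\<Gamma> x \<Psi>] assms by (simp add: mfm_subst_Var_self)
  then have "?\<Gamma> \<tturnstile> \<bottom>\<^sub>M" using assms by (intro M.nd_subst[OF assms(1)]) (auto intro: M.hyp)
  \<comment> \<open>The boxed universal formula is moved to the right, because Bernays' rule needs
    the existential formula as sole antecedent.\<close>
  then have "{\<Phi>} \<tturnstile> \<not>\<^sub>M \<box>(MAll x \<Psi>)"
    using assms by (intro M.impI) (auto simp: insert_commute)
  then have "MEx x \<Phi> \<rightarrow>\<^sub>M \<not>\<^sub>M \<box>(MAll x \<Psi>) \<in> QBK_ext \<sigma> Ax"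
    using assms by (intro QBK_ext.bernays_ex) (auto simp: M.imp_in_L_iff)
  then have "{MEx x \<Phi>} \<tturnstile> \<not>\<^sub>M \<box>(MAll x \<Psi>)" by (simp add: M.imp_in_L_iff)
  then have "insert (\<box>(MAll x \<Psi>)) {MEx x \<Phi>} \<tturnstile> \<bottom>\<^sub>M" by (rule M.impD)
  then show ?thesis by (simp add: insert_commute)
qed

lemma and_or_clash:
  assumes "{\<Phi>, \<Phi>'} \<tturnstile> \<bottom>\<^sub>M" "{\<Psi>, \<Psi>'} \<tturnstile> \<bottom>\<^sub>M"
    and w: "mfm_wf \<sigma> \<Phi>" "mfm_wf \<sigma> \<Psi>" "mfm_wf \<sigma> \<Phi>'" "mfm_wf \<sigma> \<Psi>'"
  shows "{\<Phi> \<and>\<^sub>M \<Psi>, \<Phi>' \<or>\<^sub>M \<Psi>'} \<tturnstile> \<bottom>\<^sub>M"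
proof (rule M.disE)
  let ?\<Gamma> = "{\<Phi> \<and>\<^sub>M \<Psi>, \<Phi>' \<or>\<^sub>M \<Psi>'}"
  show "?\<Gamma> \<tturnstile> \<Phi>' \<or>\<^sub>M \<Psi>'" using w by (auto intro: M.hyp)
  have c: "insert \<Theta> ?\<Gamma> \<tturnstile> \<Phi> \<and>\<^sub>M \<Psi>" for \<Theta> using w by (auto intro: M.hyp)
  show "insert \<Phi>' ?\<Gamma> \<tturnstile> \<bottom>\<^sub>M"
    using w M.conE1[OF c] by (intro M.nd_subst[OF assms(1)]) (auto intro: M.hyp)
  show "insert \<Psi>' ?\<Gamma> \<tturnstile> \<bottom>\<^sub>M"
    using w M.conE2[OF c] by (intro M.nd_subst[OF assms(2)]) (auto intro: M.hyp)
qed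

text \<open>In general \<open>tr \<Phi> False\<close> is not the strong negation of
  \<open>tr \<Phi> True\<close>, so the explosion scheme does not apply directly. It is used for
  atoms only, where the T axiom reaches the atom and its strong negation; the clash then passes
  through the connectives.\<close>

lemma tr_clash:
  assumes expl: "\<And>\<Phi> \<Psi>. \<sim>\<^sub>M \<Phi> \<rightarrow>\<^sub>M (\<Phi> \<rightarrow>\<^sub>M \<Psi>) \<in> Ax"
  shows "nfm_wf \<sigma> \<Phi> \<Longrightarrow> {tr \<Phi> True, tr \<Phi> False} \<tturnstile> \<bottom>\<^sub>M"
proof (induction \<Phi>)
  case (NAtom P ts)
  let ?A = "MAtom P ts" and ?\<Gamma> = "{tr (NAtom P ts) True, tr (NAtom P ts) False}"
  have w: "mfm_wf \<sigma> ?A" using NAtom by simp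
  have "?\<Gamma> \<tturnstile> \<box>?A" "?\<Gamma> \<tturnstile> \<sim>\<^sub>M \<diamond>?A" using w by (auto intro: M.hyp)
  then have "?\<Gamma> \<tturnstile> ?A" "?\<Gamma> \<tturnstile> \<sim>\<^sub>M ?A" using box_T neg_dia_iff[OF w] by blast+
  moreover have "?\<Gamma> \<tturnstile> \<sim>\<^sub>M ?A \<rightarrow>\<^sub>M (?A \<rightarrow>\<^sub>M \<bottom>\<^sub>M)"
    using w expl by (intro M.nd.ax QBK_ext.ax) auto
  ultimately show ?case using M.impE by blast
next
  case NBot
  then show ?case by (auto intro: M.hyp)
next
  case (NImp \<Phi> \<Psi>)
  let ?\<Gamma> = "{tr (\<Phi> \<rightarrow>\<^sub>N \<Psi>) True, tr (\<Phi> \<rightarrow>\<^sub>N \<Psi>) False}"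
  have "?\<Gamma> \<tturnstile> \<box>(tr \<Phi> True \<rightarrow>\<^sub>M tr \<Psi> True)" "?\<Gamma> \<tturnstile> tr \<Phi> True \<and>\<^sub>M tr \<Psi> False"
    using NImp.prems by (auto intro: M.hyp)
  then have "?\<Gamma> \<tturnstile> tr \<Psi> True" "?\<Gamma> \<tturnstile> tr \<Psi> False"
    using strict_impE M.conE1 M.conE2 by blast+
  then show ?case using NImp by (intro M.nd_subst[OF NImp.IH(2)]) auto
next
  case (NAnd \<Phi> \<Psi>)
  then show ?case by (auto intro!: and_or_clash)
next
  case (NOr \<Phi> \<Psi>)
  then have "{tr \<Phi> False \<and>\<^sub>M tr \<Psi> False, tr \<Phi> True \<or>\<^sub>M tr \<Psi> True} \<tturnstile> \<bottom>\<^sub>M"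
    by (intro and_or_clash) (auto simp: insert_commute)
  then show ?case by (simp add: insert_commute)
next
  case (NNeg \<Phi>)
  then show ?case by (simp add: insert_commute)
next
  case (NAll x \<Phi>)
  then have "{MEx x (tr \<Phi> False), \<box>(MAll x (tr \<Phi> True))} \<tturnstile> \<bottom>\<^sub>M"
    by (intro ex_all_clash) (auto simp: insert_commute)
  then show ?case by (simp add: insert_commute)
next
  case (NEx x \<Phi>)
  then show ?case by (auto intro: ex_all_clash)
qed

lemma tr_explosion:
  assumes expl: "\<And>\<Phi> \<Psi>. \<sim>\<^sub>M \<Phi> \<rightarrow>\<^sub>M (\<Phi> \<rightarrow>\<^sub>M \<Psi>) \<in> Ax" and w: "nfm_wf \<sigma> \<Phi>" "nfm_wf \<sigma> \<Psi>"
  shows "tr (\<sim>\<^sub>N \<Phi> \<rightarrow>\<^sub>N (\<Phi> \<rightarrow>\<^sub>N \<Psi>)) True \<in> QBK_ext \<sigma> Ax"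
  using tr_clash[OF expl w(1)] w
  by (auto intro!: strict_imp_in_QBK_ext strict_impI persistent_tr intro: M.flsE)

end

section \<open>The canonical model\<close>

lemma QN4bot_ext_wf: "\<Phi> \<in> QN4bot_ext \<sigma> Ax \<Longrightarrow> nfm_wf \<sigma> \<Phi>"
  by (induction rule: QN4bot_ext.induct) auto

section \<open>Bound variables, simultaneous substitution and renaming\<close>

primrec bv :: "('p, 'c) nfm \<Rightarrow> nat set" where
  "bv (NAtom P ts) = {}"
| "bv \<bottom>\<^sub>N = {}"
| "bv (\<Phi> \<rightarrow>\<^sub>N \<Psi>) = bv \<Phi> \<union> bv \<Psi>"
| "bv (\<Phi> \<and>\<^sub>N \<Psi>) = bv \<Phi> \<union> bv \<Psi>"
| "bv (\<Phi> \<or>\<^sub>N \<Psi>) = bv \<Phi> \<union> bv \<Psi>"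
| "bv (\<sim>\<^sub>N \<Phi>) = bv \<Phi>"
| "bv (NAll x \<Phi>) = insert x (bv \<Phi>)"
| "bv (NEx x \<Phi>) = insert x (bv \<Phi>)"

text \<open>
  This substitution does not avoid capture. In the canonical model the terms of the domain contain
  no variable that is bound in the formula under consideration.
\<close>

primrec tm_msubst :: "(nat \<Rightarrow> 'c tm) \<Rightarrow> 'c tm \<Rightarrow> 'c tm" where
  "tm_msubst e (Var x) = e x"
| "tm_msubst e (Const c) = Const c"

primrec msubst :: "(nat \<Rightarrow> 'c tm) \<Rightarrow> ('p, 'c) nfm \<Rightarrow> ('p, 'c) nfm" where
  "msubst e (NAtom P ts) = NAtom P (map (tm_msubst e) ts)"
| "msubst e \<bottom>\<^sub>N = \<bottom>\<^sub>N"
| "msubst e (\<Phi> \<rightarrow>\<^sub>N \<Psi>) = msubst e \<Phi> \<rightarrow>\<^sub>N msubst e \<Psi>"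
| "msubst e (\<Phi> \<and>\<^sub>N \<Psi>) = msubst e \<Phi> \<and>\<^sub>N msubst e \<Psi>"
| "msubst e (\<Phi> \<or>\<^sub>N \<Psi>) = msubst e \<Phi> \<or>\<^sub>N msubst e \<Psi>"
| "msubst e (\<sim>\<^sub>N \<Phi>) = \<sim>\<^sub>N (msubst e \<Phi>)"
| "msubst e (NAll x \<Phi>) = NAll x (msubst (e(x := Var x)) \<Phi>)"
| "msubst e (NEx x \<Phi>) = NEx x (msubst (e(x := Var x)) \<Phi>)"

lemma finite_bv: "finite (bv \<Phi>)"
  by (induction \<Phi>) auto

lemma finite_fv: "finite (nfm_fv \<Phi>)"
proof (induction \<Phi>)
  case (NAtom P ts)
  have "finite (tm_vars t)" for t :: "'b tm" by (cases t) auto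
  then show ?case by simp
qed auto

lemma bv_msubst [simp]: "bv (msubst e \<Phi>) = bv \<Phi>"
  by (induction \<Phi> arbitrary: e) auto

lemma wf_msubst:
  "nfm_wf \<sigma> \<Phi> \<Longrightarrow> (\<And>x. tm_wf \<sigma> (e x)) \<Longrightarrow> nfm_wf \<sigma> (msubst e \<Phi>)"
proof (induction \<Phi> arbitrary: e)
  case (NAtom P ts)
  have "tm_wf \<sigma> (tm_msubst e t)" if "tm_wf \<sigma> t" for t using that NAtom.prems(2) by (cases t) auto
  then show ?case using NAtom by auto
qed auto

lemma msubst_eq_self: "(\<And>x. x \<in> nfm_fv \<Phi> \<Longrightarrow> e x = Var x) \<Longrightarrow> msubst e \<Phi> = \<Phi>"
proof (induction \<Phi> arbitrary: e)
  case (NAtom P ts)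
  have "tm_msubst e t = t" if t: "t \<in> set ts" for t
  proof (cases t)
    case (Var x)
    then have "x \<in> nfm_fv (NAtom P ts)" using t by force
    then show ?thesis using NAtom.prems Var by simp
  qed simp
  then show ?case by (simp add: map_idI)
qed auto

text \<open>The premise keeps \<open>x\<close> out of the values at other variables, so that the
  outer substitution replaces nothing but the placeholder \<open>Var x\<close>.\<close>

lemma subst_msubst:
  assumes "\<And>y. y \<noteq> x \<Longrightarrow> x \<notin> tm_vars (e y)"
  shows "nfm_subst x d (msubst (e(x := Var x)) \<Phi>) = msubst (e(x := d)) \<Phi>"
  using assms
proof (induction \<Phi> arbitrary: e)
  case (NAtom P ts)
  have *: "tm_subst x d s = s" if "x \<notin> tm_vars s" for s using that by (cases s) auto
  have "tm_subst x d (tm_msubst (e(x := Var x)) t) = tm_msubst (e(x := d)) t" for t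
    using NAtom by (cases t) (auto simp: *)
  then show ?case by (simp del: fun_upd_apply)
next
  case (NAll y \<Phi>)
  show ?case
  proof (cases "y = x")
    case False
    have "nfm_subst x d (msubst (e(y := Var y, x := Var x)) \<Phi>) = msubst (e(y := Var y, x := d)) \<Phi>"
      by (rule NAll.IH) (use NAll.prems False in auto)
    then show ?thesis using False by (simp add: fun_upd_twist del: fun_upd_apply)
  qed (simp del: fun_upd_apply)
next
  case (NEx y \<Phi>)
  show ?case
  proof (cases "y = x")
    case False
    have "nfm_subst x d (msubst (e(y := Var y, x := Var x)) \<Phi>) = msubst (e(y := Var y, x := d)) \<Phi>"
      by (rule NEx.IH) (use NEx.prems False in auto)
    then show ?thesis using False by (simp add: fun_upd_twist del: fun_upd_apply)
  qed (simp del: fun_upd_apply)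
qed simp_all

lemma free_for_bv: "bv \<Phi> \<inter> tm_vars t = {} \<Longrightarrow> nfm_free_for t x \<Phi>"
  by (induction \<Phi>) auto

lemma nfm_subst_fresh: "x \<notin> nfm_fv \<Phi> \<Longrightarrow> nfm_subst x t \<Phi> = \<Phi>"
proof (induction \<Phi>)
  case (NAtom P ts)
  have "tm_subst x t s = s" if "s \<in> set ts" for s
    using NAtom that by (cases s) auto
  then show ?case by (simp add: map_idI)
qed auto

text \<open>Renaming to a fresh variable can be undone; together with \<open>free_for_back\<close>
  this lets an instantiation axiom recover a formula from its renamed variant.\<close>

lemma nfm_subst_back:
  "y \<notin> nfm_fv \<Phi> \<union> bv \<Phi> \<Longrightarrow> nfm_subst y (Var x) (nfm_subst x (Var y) \<Phi>) = \<Phi>"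
proof (induction \<Phi>)
  case (NAtom P ts)
  have "tm_subst y (Var x) (tm_subst x (Var y) s) = s" if "s \<in> set ts" for s
    using NAtom that by (cases s) auto
  then show ?case by (simp add: map_idI)
qed (auto simp: nfm_subst_fresh)

lemma free_for_back:
  "y \<notin> nfm_fv \<Phi> \<union> bv \<Phi> \<Longrightarrow> nfm_free_for (Var x) y (nfm_subst x (Var y) \<Phi>)"
  by (induction \<Phi>) auto

lemma fv_subst_Var: "nfm_fv (nfm_subst x (Var y) \<Phi>) \<subseteq> nfm_fv \<Phi> - {x} \<union> {y}"
proof (induction \<Phi>)
  case (NAtom P ts)
  have "tm_vars (tm_subst x (Var y) s) \<subseteq> tm_vars s - {x} \<union> {y}" for s :: "'b tm" by (cases s) auto
  then show ?case by fastforce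
qed auto

lemma wf_subst: "nfm_wf \<sigma> \<Phi> \<Longrightarrow> tm_wf \<sigma> t \<Longrightarrow> nfm_wf \<sigma> (nfm_subst x t \<Phi>)"
proof (induction \<Phi>)
  case (NAtom P ts)
  have "tm_wf \<sigma> (tm_subst x t s)" if "tm_wf \<sigma> s" for s using that NAtom.prems(2) by (cases s) auto
  then show ?case using NAtom by auto
qed auto

text \<open>\<open>B\<close> collects the variables bound in the formula under consideration. Its
  finiteness leaves infinitely many variables for use as domain elements and eigenvariables.\<close>

locale canonical =
  fixes \<sigma> :: "('p, 'c) signature" and Ax :: "('p, 'c) nfm set" and B :: "nat set"
  assumes finite_B: "finite B"
begin

sublocale int_calculus "nfm_wf \<sigma>" NImp NAnd NOr NBot "QN4bot_ext \<sigma> Ax"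
proof
  show "\<psi> \<in> QN4bot_ext \<sigma> Ax" if "\<phi> \<in> QN4bot_ext \<sigma> Ax" "\<phi> \<rightarrow>\<^sub>N \<psi> \<in> QN4bot_ext \<sigma> Ax" for \<phi> \<psi>
    using that by (rule QN4bot_ext.mp)
qed (auto intro: QN4bot_ext_wf QN4bot_ext.ax QN4bot_axioms.intros)

notation nd (infix "\<tturnstile>" 50)

lemma all_instE:
  assumes "nfm_free_for t x \<Phi>" "nfm_wf \<sigma> \<Phi>" "nfm_wf \<sigma> (nfm_subst x t \<Phi>)"
  shows "{NAll x \<Phi>} \<tturnstile> nfm_subst x t \<Phi>"
proof -
  have "NAll x \<Phi> \<rightarrow>\<^sub>N nfm_subst x t \<Phi> \<in> QN4bot_ext \<sigma> Ax"
    using assms by (intro QN4bot_ext.ax) (auto intro: QN4bot_axioms.intros)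
  then show ?thesis by (simp add: imp_in_L_iff)
qed

lemma ex_instI:
  assumes "nfm_free_for t x \<Phi>" "nfm_wf \<sigma> \<Phi>" "nfm_wf \<sigma> (nfm_subst x t \<Phi>)"
  shows "{nfm_subst x t \<Phi>} \<tturnstile> NEx x \<Phi>"
proof -
  have "nfm_subst x t \<Phi> \<rightarrow>\<^sub>N NEx x \<Phi> \<in> QN4bot_ext \<sigma> Ax"
    using assms by (intro QN4bot_ext.ax) (auto intro: QN4bot_axioms.intros)
  then show ?thesis by (simp add: imp_in_L_iff)
qed

lemma allI: "{\<Phi>} \<tturnstile> \<Psi> \<Longrightarrow> nfm_wf \<sigma> \<Phi> \<Longrightarrow> x \<notin> nfm_fv \<Phi> \<Longrightarrow> {\<Phi>} \<tturnstile> NAll x \<Psi>"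
  using QN4bot_ext.bernays_all[where \<sigma> = \<sigma> and Ax = Ax and \<Phi> = \<Phi> and \<Psi> = \<Psi> and x = x]
  by (simp add: imp_in_L_iff)

lemma exE: "{\<Phi>} \<tturnstile> \<Psi> \<Longrightarrow> nfm_wf \<sigma> \<Phi> \<Longrightarrow> x \<notin> nfm_fv \<Psi> \<Longrightarrow> {NEx x \<Phi>} \<tturnstile> \<Psi>"
  using QN4bot_ext.bernays_ex[where \<sigma> = \<sigma> and Ax = Ax and \<Phi> = \<Phi> and \<Psi> = \<Psi> and x = x]
  by (simp add: imp_in_L_iff)

text \<open>Bernays' rule with an eigenvariable other than the quantified one: generalize over
  \<open>y\<close> first, then rename the bound variable back to \<open>x\<close>.\<close>

lemma allI_fresh:
  assumes "{\<Phi>} \<tturnstile> nfm_subst x (Var y) \<Psi>" "nfm_wf \<sigma> \<Phi>" "nfm_wf \<sigma> \<Psi>"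
    and y: "y \<notin> nfm_fv \<Phi>" "y \<notin> nfm_fv \<Psi> \<union> bv \<Psi>"
  shows "{\<Phi>} \<tturnstile> NAll x \<Psi>"
proof -
  let ?\<Psi> = "nfm_subst x (Var y) \<Psi>"
  have w: "nfm_wf \<sigma> ?\<Psi>" using assms by (intro wf_subst) auto
  have "{NAll y ?\<Psi>} \<tturnstile> \<Psi>"
    using all_instE[OF free_for_back[OF y(2)] w] assms(3) by (simp add: nfm_subst_back[OF y(2)])
  then have "{NAll y ?\<Psi>} \<tturnstile> NAll x \<Psi>"
    using w fv_subst_Var[of x y \<Psi>] by (intro allI) auto
  then show ?thesis using allI[OF assms(1,2) y(1)] nd_trans by blast
qed

lemma exE_fresh:
  assumes "{nfm_subst x (Var y) \<Phi>} \<tturnstile> \<Psi>" "nfm_wf \<sigma> \<Phi>"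
    and y: "y \<notin> nfm_fv \<Psi>" "y \<notin> nfm_fv \<Phi> \<union> bv \<Phi>"
  shows "{NEx x \<Phi>} \<tturnstile> \<Psi>"
proof -
  let ?\<Phi> = "nfm_subst x (Var y) \<Phi>"
  have w: "nfm_wf \<sigma> ?\<Phi>" using assms by (intro wf_subst) auto
  have "{\<Phi>} \<tturnstile> NEx y ?\<Phi>"
    using ex_instI[OF free_for_back[OF y(2)] w] assms(2) by (simp add: nfm_subst_back[OF y(2)])
  then have "{NEx x \<Phi>} \<tturnstile> NEx y ?\<Phi>"
    using assms(2) fv_subst_Var[of x y \<Phi>] by (intro exE) auto
  then show ?thesis using exE[OF assms(1) w y(1)] nd_trans by blast
qed

section \<open>The term domain and the interpretation by embedded formulas\<close>

definition D :: "'c tm set" where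
  "D = {t. tm_wf \<sigma> t \<and> tm_vars t \<inter> B = {}}"

lemma ex_fresh: "finite A \<Longrightarrow> \<exists>y. y \<notin> A \<and> Var y \<in> D"
  using ex_new_if_finite[of "A \<union> B"] finite_B unfolding D_def by auto

definition fresh_var :: nat where
  "fresh_var = (SOME y. Var y \<in> D)"

lemma fresh_var_in_D: "Var fresh_var \<in> D"
  unfolding fresh_var_def using ex_fresh[of "{}"] by (auto intro: someI2_ex)

text \<open>The model interprets every element of the type of constants, so those outside the
  signature need some default in \<open>D\<close>.\<close>

definition cst :: "'c \<Rightarrow> 'c tm" where
  "cst c = (if c \<in> constants \<sigma> then Const c else Var fresh_var)"

text \<open>Falsification of an atom is the value of its strong negation, treated as a formula in
  its own right. Ill-formed atoms get an arbitrary regular value, the empty set.\<close>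

definition I :: "bool \<Rightarrow> 'p \<Rightarrow> 'c tm list \<Rightarrow> (('p, 'c) nfm \<times> ('p, 'c) nfm) set" where
  "I b P ts = (if nfm_wf \<sigma> (NAtom P ts)
     then emb (if b then NAtom P ts else \<sim>\<^sub>N (NAtom P ts)) else {})"

lemma I_wf:
  assumes "nfm_wf \<sigma> (NAtom P ts)"
  shows "I True P ts = emb (NAtom P ts)" "I False P ts = emb (\<sim>\<^sub>N (NAtom P ts))"
  using assms unfolding I_def by auto

lemma I_not_wf: "\<not> nfm_wf \<sigma> (NAtom P ts) \<Longrightarrow> I b P ts = {}"
  unfolding I_def by auto

sublocale can: twist_model cond ext "emb ` Collect (nfm_wf \<sigma>)" D cst I
proof
  show "D \<noteq> {}" using fresh_var_in_D by blast
  show "cst c \<in> D" for c using fresh_var_in_D unfolding cst_def by (auto simp: D_def)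
  show "can.regular (I b P ds)" for b P ds
    by (cases "nfm_wf \<sigma> (NAtom P ds)"; cases b)
      (use I_wf I_not_wf regular_emb can.regular_empty in auto)
qed

text \<open>All terms of \<open>D\<close> can be instantiated without capture. Conversely
  \<open>D\<close> contains a variable fresh for a given lower bound \<chi> of the instances, and
  this variable serves as eigenvariable.\<close>

lemma emb_All:
  assumes e: "range e \<subseteq> D" and x: "x \<in> B" and \<Psi>: "bv \<Psi> \<subseteq> B" "nfm_wf \<sigma> \<Psi>"
  shows "can.box (\<Inter>d\<in>D. emb (msubst (e(x := d)) \<Psi>)) = emb (msubst e (NAll x \<Psi>))"
proof -
  let ?S = "(\<lambda>d. msubst (e(x := d)) \<Psi>) ` D"
  let ?A = "msubst (e(x := Var x)) \<Psi>"
  \<comment> \<open>As \<open>x\<close> lies in \<open>B\<close>, it occurs in no value of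
    \<open>e\<close>; thus instantiating the placeholder is the same as updating the
    assignment.\<close>
  have sub: "nfm_subst x d ?A = msubst (e(x := d)) \<Psi>" for d
    using e x by (intro subst_msubst) (auto simp: D_def)
  have wfe: "tm_wf \<sigma> (e y)" for y using e by (auto simp: D_def)
  have w: "nfm_wf \<sigma> (msubst (e(x := d)) \<Psi>)" if "tm_wf \<sigma> d" for d
    using that wfe \<Psi> by (intro wf_msubst) auto
  then have wA: "nfm_wf \<sigma> ?A" by simp
  have "can.box (\<Inter>\<alpha>\<in>?S. emb \<alpha>) = emb (NAll x ?A)"
  proof (rule emb_inf)
    show "nfm_wf \<sigma> (NAll x ?A)" using wA by simp
    show "?S \<noteq> {}" using fresh_var_in_D by blast
    fix \<alpha> assume "\<alpha> \<in> ?S"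
    then obtain d where d: "d \<in> D" "\<alpha> = msubst (e(x := d)) \<Psi>" by blast
    then show w\<alpha>: "nfm_wf \<sigma> \<alpha>" using w unfolding D_def by blast
    have "bv ?A \<inter> tm_vars d = {}" using d(1) \<Psi>(1) unfolding D_def bv_msubst by blast
    then have "{NAll x ?A} \<tturnstile> nfm_subst x d ?A"
      using w\<alpha> wA unfolding d(2) by (intro all_instE free_for_bv) (simp_all only: sub)
    then show "{NAll x ?A} \<tturnstile> \<alpha>" unfolding sub d(2) .
  next
    fix \<chi> assume \<chi>: "nfm_wf \<sigma> \<chi>" "\<And>\<alpha>. \<alpha> \<in> ?S \<Longrightarrow> {\<chi>} \<tturnstile> \<alpha>"
    obtain y where y: "y \<notin> nfm_fv \<chi> \<union> nfm_fv ?A \<union> bv ?A" "Var y \<in> D"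
      using ex_fresh[of "nfm_fv \<chi> \<union> nfm_fv ?A \<union> bv ?A"] finite_fv finite_bv by blast
    have "{\<chi>} \<tturnstile> nfm_subst x (Var y) ?A" using \<chi>(2) y(2) unfolding sub by blast
    then show "{\<chi>} \<tturnstile> NAll x ?A" using \<chi>(1) wA y(1) by (intro allI_fresh) auto
  qed
  then show ?thesis by simp
qed

lemma emb_Ex:
  assumes e: "range e \<subseteq> D" and x: "x \<in> B" and \<Psi>: "bv \<Psi> \<subseteq> B" "nfm_wf \<sigma> \<Psi>"
  shows "can.reg (\<Union>d\<in>D. emb (msubst (e(x := d)) \<Psi>)) = emb (msubst e (NEx x \<Psi>))"
proof -
  let ?S = "(\<lambda>d. msubst (e(x := d)) \<Psi>) ` D"
  let ?A = "msubst (e(x := Var x)) \<Psi>"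
  have sub: "nfm_subst x d ?A = msubst (e(x := d)) \<Psi>" for d
    using e x by (intro subst_msubst) (auto simp: D_def)
  have wfe: "tm_wf \<sigma> (e y)" for y using e by (auto simp: D_def)
  have w: "nfm_wf \<sigma> (msubst (e(x := d)) \<Psi>)" if "tm_wf \<sigma> d" for d
    using that wfe \<Psi> by (intro wf_msubst) auto
  then have wA: "nfm_wf \<sigma> ?A" by simp
  have "can.reg (\<Union>\<alpha>\<in>?S. emb \<alpha>) = emb (NEx x ?A)"
  proof (rule emb_sup)
    show "nfm_wf \<sigma> (NEx x ?A)" using wA by simp
    fix \<alpha> assume "\<alpha> \<in> ?S"
    then obtain d where d: "d \<in> D" "\<alpha> = msubst (e(x := d)) \<Psi>" by blast
    then show w\<alpha>: "nfm_wf \<sigma> \<alpha>" using w unfolding D_def by blast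
    have "bv ?A \<inter> tm_vars d = {}" using d(1) \<Psi>(1) unfolding D_def bv_msubst by blast
    then have "{nfm_subst x d ?A} \<tturnstile> NEx x ?A"
      using w\<alpha> wA unfolding d(2) by (intro ex_instI free_for_bv) (simp_all only: sub)
    then show "{\<alpha>} \<tturnstile> NEx x ?A" unfolding sub d(2) .
  next
    fix \<phi> \<theta> assume \<phi>: "nfm_wf \<sigma> \<phi>" "nfm_wf \<sigma> \<theta>" "\<And>\<alpha>. \<alpha> \<in> ?S \<Longrightarrow> {\<alpha>, \<phi>} \<tturnstile> \<theta>"
    let ?F = "nfm_fv \<phi> \<union> nfm_fv \<theta> \<union> nfm_fv ?A \<union> bv ?A"
    obtain y where y: "y \<notin> ?F" "Var y \<in> D" using ex_fresh[of ?F] finite_fv finite_bv by blast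
    have "{nfm_subst x (Var y) ?A, \<phi>} \<tturnstile> \<theta>" using \<phi>(3) y(2) unfolding sub by blast
    \<comment> \<open>The side formula \<phi> is hidden in an implication, since the rule for the
      existential quantifier admits a single antecedent; \<open>y\<close> is fresh for this
      implication too.\<close>
    then have "{nfm_subst x (Var y) ?A} \<tturnstile> \<phi> \<rightarrow>\<^sub>N \<theta>"
      using \<phi> by (intro impI) (simp_all add: insert_commute)
    then have "{NEx x ?A} \<tturnstile> \<phi> \<rightarrow>\<^sub>N \<theta>" using wA y(1) by (intro exE_fresh) auto
    then show "{NEx x ?A, \<phi>} \<tturnstile> \<theta>" using impD[of "{NEx x ?A}"] by (simp add: insert_commute)
  qed
  then show ?thesis by simp
qed

lemma tm_val_eq_msubst: "tm_wf \<sigma> t \<Longrightarrow> can.tm_val e t = tm_msubst e t"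
  by (cases t) (auto simp: cst_def)

text \<open>Truth lemma. Each box introduced by \<tau> is absorbed: on atoms by
  \<open>box_emb\<close>, on implications by \<open>emb_imp\<close>, on universal formulas by
  \<open>emb_All\<close>.\<close>

lemma val_\<tau>:
  "nnf \<Psi> \<Longrightarrow> nfm_wf \<sigma> \<Psi> \<Longrightarrow> bv \<Psi> \<subseteq> B \<Longrightarrow> range e \<subseteq> D \<Longrightarrow> can.val (\<tau> \<Psi>) True e = emb (msubst e \<Psi>)"
proof (induction \<Psi> arbitrary: e)
  case (NAtom P ts)
  have "map (can.tm_val e) ts = map (tm_msubst e) ts"
    using NAtom by (auto intro: tm_val_eq_msubst)
  moreover have "nfm_wf \<sigma> (msubst e (NAtom P ts))"
    using NAtom by (intro wf_msubst) (auto simp: D_def)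
  ultimately show ?case by (simp add: I_wf box_emb del: map_eq_conv nfm_wf.simps)
next
  case NBot
  show ?case by (simp add: emb_fls)
next
  case (NImp \<Phi> \<Psi>)
  have "nfm_wf \<sigma> (msubst e \<Phi>)" "nfm_wf \<sigma> (msubst e \<Psi>)"
    using NImp.prems by (auto intro!: wf_msubst simp: D_def)
  then show ?case using NImp by (simp add: emb_imp)
next
  case (NAnd \<Phi> \<Psi>)
  have "nfm_wf \<sigma> (msubst e \<Phi>)" "nfm_wf \<sigma> (msubst e \<Psi>)"
    using NAnd.prems by (auto intro!: wf_msubst simp: D_def)
  then show ?case using NAnd by (simp add: emb_con)
next
  case (NOr \<Phi> \<Psi>)
  have "nfm_wf \<sigma> (msubst e \<Phi>)" "nfm_wf \<sigma> (msubst e \<Psi>)"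
    using NOr.prems by (auto intro!: wf_msubst simp: D_def)
  then show ?case using NOr by (simp add: emb_dis)
next
  case (NNeg \<Phi>)
  then consider P ts where "\<Phi> = NAtom P ts" | "\<Phi> = \<bottom>\<^sub>N" by auto
  then show ?case
  proof cases
    case 1
    have "map (can.tm_val e) ts = map (tm_msubst e) ts"
      using NNeg.prems 1 by (auto intro: tm_val_eq_msubst)
    moreover have "nfm_wf \<sigma> (msubst e (NAtom P ts))"
      using NNeg.prems 1 by (intro wf_msubst) (auto simp: D_def)
    \<comment> \<open>Falsification of a diamond is the box of the falsification of its argument,
      here the embedding of a strongly negated atom, which the box fixes.\<close>
    ultimately show ?thesis
      unfolding 1 by (simp add: I_wf box_emb del: map_eq_conv nfm_wf.simps(1))
  next
    case 2
    have "\<sim>\<^sub>N \<bottom>\<^sub>N \<in> QN4bot_ext \<sigma> Ax" by (intro QN4bot_ext.ax) (auto intro: QN4bot_axioms.intros)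
    then show ?thesis unfolding 2 by (simp add: emb_top)
  qed
next
  case (NAll x \<Psi>)
  have "can.val (\<tau> \<Psi>) True (e(x := d)) = emb (msubst (e(x := d)) \<Psi>)" if "d \<in> D" for d
    using NAll.prems that by (intro NAll.IH can.range_upd) auto
  then show ?case using NAll.prems emb_All[of e x \<Psi>] by (simp del: fun_upd_apply msubst.simps)
next
  case (NEx x \<Psi>)
  have "can.val (\<tau> \<Psi>) True (e(x := d)) = emb (msubst (e(x := d)) \<Psi>)" if "d \<in> D" for d
    using NEx.prems that by (intro NEx.IH can.range_upd) auto
  then show ?case using NEx.prems emb_Ex[of e x \<Psi>] by (simp del: fun_upd_apply msubst.simps)
qed

lemma \<tau>_valid_imp_derivable:
  assumes "nnf \<Phi>" "nfm_wf \<sigma> \<Phi>" "bv \<Phi> \<subseteq> B" "nfm_fv \<Phi> = {}" "can.valid (\<tau> \<Phi>)"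
  shows "\<Phi> \<in> QN4bot_ext \<sigma> Ax"
proof -
  \<comment> \<open>The identity is not an assignment into \<open>D\<close> unless \<open>B\<close>
    is empty. On a sentence any assignment acts as the identity, which explains the restriction to
    closed formulas.\<close>
  let ?e = "\<lambda>_. Var fresh_var"
  have e: "range ?e \<subseteq> D" using fresh_var_in_D by auto
  have "emb (msubst ?e \<Phi>) = cond" using assms e val_\<tau>[of \<Phi> ?e] unfolding can.valid_def by auto
  then show ?thesis using assms(2,4) msubst_eq_self[of \<Phi> ?e] emb_eq_cond_iff by auto
qed

text \<open>Explosion in Nelson's logic makes an atom and its strong negation have disjoint
  embeddings; disjointness then extends to all modal formulas.\<close>

lemma explosion_valid:
  assumes "\<And>\<Phi> \<Psi>. \<sim>\<^sub>N \<Phi> \<rightarrow>\<^sub>N (\<Phi> \<rightarrow>\<^sub>N \<Psi>) \<in> Ax"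
  shows "can.valid (\<sim>\<^sub>M \<Phi> \<rightarrow>\<^sub>M (\<Phi> \<rightarrow>\<^sub>M \<Psi>))"
proof -
  have "I True P ts \<inter> I False P ts = {}" for P ts
  proof (cases "nfm_wf \<sigma> (NAtom P ts)")
    case True
    let ?A = "NAtom P ts"
    have "\<sim>\<^sub>N ?A \<rightarrow>\<^sub>N (?A \<rightarrow>\<^sub>N \<bottom>\<^sub>N) \<in> QN4bot_ext \<sigma> Ax"
      using assms True by (intro QN4bot_ext.ax) auto
    then have "{?A, \<sim>\<^sub>N ?A} \<tturnstile> \<bottom>\<^sub>N" using impD[of "{\<sim>\<^sub>N ?A}" ?A] by (simp add: imp_in_L_iff)
    then have "emb (?A \<and>\<^sub>N \<sim>\<^sub>N ?A) \<subseteq> emb \<bottom>\<^sub>N"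
      using True by (subst emb_subset_iff) (simp_all add: nd_con_left)
    then have "emb ?A \<inter> emb (\<sim>\<^sub>N ?A) = {}" using True by (subst (asm) emb_con) (auto simp: emb_fls)
    then show ?thesis using I_wf[OF True] by simp
  next
    case False
    then show ?thesis using I_not_wf by blast
  qed
  then have "can.val \<Phi> True e \<inter> can.val \<Phi> False e = {}" for e by (rule can.val_True_Int_False)
  then have "can.val \<Phi> False e \<inter> can.val \<Phi> True e \<subseteq> can.val \<Psi> True e" for e by blast
  then show ?thesis by (simp add: can.valid_imp_iff can.subset_himp)
qed

end

section \<open>Universal closures\<close>

lemma fv_foldr_NAll: "nfm_fv (foldr NAll xs \<Phi>) = nfm_fv \<Phi> - set xs"
  by (induction xs) auto

lemma wf_foldr_NAll: "nfm_wf \<sigma> (foldr NAll xs \<Phi>) \<longleftrightarrow> nfm_wf \<sigma> \<Phi>"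
  by (induction xs) auto

lemma nnf_foldr_NAll: "nnf (foldr NAll xs \<Phi>) \<longleftrightarrow> nnf \<Phi>"
  by (induction xs) auto

lemma nfm_subst_Var_self: "nfm_subst x (Var x) \<Phi> = \<Phi>"
proof (induction \<Phi>)
  case (NAtom P ts)
  have "tm_subst x (Var x) s = s" for s :: "'b tm" by (cases s) auto
  then show ?case by (simp add: map_idI)
qed auto

lemma nfm_free_for_Var_self: "nfm_free_for (Var x) x \<Phi>"
  by (induction \<Phi>) auto

lemma QN4bot_ext_foldr_NAllD: "foldr NAll xs \<Phi> \<in> QN4bot_ext \<sigma> Ax \<Longrightarrow> \<Phi> \<in> QN4bot_ext \<sigma> Ax"
proof (induction xs)
  case (Cons x xs)
  let ?\<Psi> = "foldr NAll xs \<Phi>"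
  have "nfm_wf \<sigma> ?\<Psi>" using QN4bot_ext_wf[OF Cons.prems] by simp
  then have "NAll x ?\<Psi> \<rightarrow>\<^sub>N ?\<Psi> \<in> QN4bot_ext \<sigma> Ax"
    using QN4bot_axioms.all_inst[OF nfm_free_for_Var_self, of x ?\<Psi>]
    by (intro QN4bot_ext.ax) (auto simp: nfm_subst_Var_self)
  then show ?case using Cons QN4bot_ext.mp by auto
qed simp

context s4_extension
begin

text \<open>Generalization is obtained from Bernays' rule with the closed antecedent
  \<open>?T\<close>, and necessitation adds the box required by \<tau>.\<close>

lemma \<tau>_foldr_NAll: "\<tau> \<Phi> \<in> QBK_ext \<sigma> Ax \<Longrightarrow> \<tau> (foldr NAll xs \<Phi>) \<in> QBK_ext \<sigma> Ax"
proof (induction xs)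
  case (Cons x xs)
  let ?\<Psi> = "\<tau> (foldr NAll xs \<Phi>)" and ?T = "\<bottom>\<^sub>M \<rightarrow>\<^sub>M \<bottom>\<^sub>M"
  have "?\<Psi> \<in> QBK_ext \<sigma> Ax" using Cons by simp
  then have "?T \<rightarrow>\<^sub>M ?\<Psi> \<in> QBK_ext \<sigma> Ax" by (simp add: M.imp_in_L_iff M.nd.ax)
  then have "?T \<rightarrow>\<^sub>M MAll x ?\<Psi> \<in> QBK_ext \<sigma> Ax" by (rule QBK_ext.bernays_all) simp
  then have "MAll x ?\<Psi> \<in> QBK_ext \<sigma> Ax" by (rule QBK_ext.mp[OF M.ax_fls, rotated]) simp
  then show ?case using nec by simp
qed simp

end

theorem theorem26:
  fixes \<sigma> :: "('p, 'c) signature" and \<Phi> :: "('p, 'c) nfm"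
  assumes "nfm_wf \<sigma> \<Phi>" and "nnf \<Phi>"
  shows "(\<Phi> \<in> QN4bot \<sigma> \<longleftrightarrow> \<tau> \<Phi> \<in> QBS4 \<sigma>) \<and> (\<Phi> \<in> QN3 \<sigma> \<longleftrightarrow> \<tau> \<Phi> \<in> QB3S4 \<sigma>)"
proof -
  \<comment> \<open>The canonical model decides sentences only, so the converse direction passes
    through a universal closure of \<Phi>.\<close>
  obtain xs where xs: "set xs = nfm_fv \<Phi>" using finite_list[OF finite_fv] by blast
  define \<Psi> where "\<Psi> = foldr NAll xs \<Phi>"
  have \<Psi>: "nnf \<Psi>" "nfm_wf \<sigma> \<Psi>" "bv \<Psi> \<subseteq> bv \<Psi>" "nfm_fv \<Psi> = {}"
    using assms by (auto simp: \<Psi>_def nnf_foldr_NAll wf_foldr_NAll fv_foldr_NAll xs)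
  let ?N3 = "{\<sim>\<^sub>N \<Phi> \<rightarrow>\<^sub>N (\<Phi> \<rightarrow>\<^sub>N \<Psi>) | \<Phi> \<Psi>. True} :: ('p, 'c) nfm set"
  let ?B3 = "{\<sim>\<^sub>M \<Phi> \<rightarrow>\<^sub>M (\<Phi> \<rightarrow>\<^sub>M \<Psi>) | \<Phi> \<Psi>. True} :: ('p, 'c) mfm set"
  interpret S4: s4_extension \<sigma> "S4_axioms :: ('p, 'c) mfm set" by unfold_locales simp
  interpret B3: s4_extension \<sigma> "S4_axioms \<union> ?B3" by unfold_locales simp
  \<comment> \<open>The model depends on the formula: \<open>B\<close> consists of the variables
    bound in the closure, including those bound by the closing quantifiers.\<close>
  interpret C4: canonical \<sigma> "{}" "bv \<Psi>" by unfold_locales (rule finite_bv)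
  interpret C3: canonical \<sigma> ?N3 "bv \<Psi>" by unfold_locales (rule finite_bv)
  have "\<tau> \<Phi> \<in> QBS4 \<sigma>" if "\<Phi> \<in> QN4bot \<sigma>"
    using S4.tr_QN4bot_ext[of "{}" \<Phi>] that tr_nnf[OF assms(2)] by (simp add: QN4bot_def QBS4_def)
  moreover have "\<tau> \<Phi> \<in> QB3S4 \<sigma>" if "\<Phi> \<in> QN3 \<sigma>"
  proof -
    have "tr \<Theta> True \<in> QBK_ext \<sigma> (S4_axioms \<union> ?B3)" if "\<Theta> \<in> ?N3" "nfm_wf \<sigma> \<Theta>" for \<Theta>
      using that B3.tr_explosion by fastforce
    then show ?thesis
      using B3.tr_QN4bot_ext[of ?N3 \<Phi>] that tr_nnf[OF assms(2)] by (simp add: QN3_def QB3S4_def)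
  qed
  moreover have "\<Phi> \<in> QN4bot \<sigma>" if "\<tau> \<Phi> \<in> QBS4 \<sigma>"
  proof -
    have "\<tau> \<Psi> \<in> QBK_ext \<sigma> S4_axioms"
      using S4.\<tau>_foldr_NAll that by (simp add: QBS4_def \<Psi>_def)
    then have "C4.can.valid (\<tau> \<Psi>)"
      by (rule C4.can.QBK_ext_valid[rotated]) (rule C4.can.S4_axioms_valid)
    then have "\<Psi> \<in> QN4bot_ext \<sigma> {}" using \<Psi> by (intro C4.\<tau>_valid_imp_derivable)
    then show ?thesis unfolding QN4bot_def \<Psi>_def by (rule QN4bot_ext_foldr_NAllD)
  qed
  moreover have "\<Phi> \<in> QN3 \<sigma>" if "\<tau> \<Phi> \<in> QB3S4 \<sigma>"
  proof -
    have "\<tau> \<Psi> \<in> QBK_ext \<sigma> (S4_axioms \<union> ?B3)"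
      using B3.\<tau>_foldr_NAll that by (simp add: QB3S4_def \<Psi>_def)
    moreover have "C3.can.valid \<Theta>" if "\<Theta> \<in> S4_axioms \<union> ?B3" for \<Theta>
      using that C3.can.S4_axioms_valid C3.explosion_valid by blast
    ultimately have "C3.can.valid (\<tau> \<Psi>)" by (rule C3.can.QBK_ext_valid[rotated])
    then have "\<Psi> \<in> QN4bot_ext \<sigma> ?N3" using \<Psi> by (intro C3.\<tau>_valid_imp_derivable)
    then show ?thesis unfolding QN3_def \<Psi>_def by (rule QN4bot_ext_foldr_NAllD)
  qed
  ultimately show ?thesis by blast
qed

end
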